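(* Let $(\xi_n)_{n=0}^\infty$ be a sequence of independent Bernoulli random variables such that $\xi_n=1$ with probability $\frac{1}{n+1}$ and $\xi_n=0$ with probability $1-\frac1{n+1}$. Then for almost every realization $\xi=(\xi_n)_{n\ge0}$, the determinantal point process on $\mathbb{D}$ (with respect to the normalized Lebesgue measure $dm$) induced by the kernel $$K^{f_\xi}(z,w)=\sum_{n=0}^\infty \xi_n(n+1)z^n\bar w^n,\qquad z,w\in\mathbb{D},$$ is number rigid.
   Context: $\mathbb{D}$ is the open unit disc in $\mathbb{C}$, equipped with the normalized Lebesgue measure $dm$ (so $m(\mathbb{D})=1$). Point processes: $\mathrm{Conf}(\mathbb{D})$ is the space of configurations on $\mathbb{D}$, i.e. non-negative integer-valued Radon measures on $\mathbb{D}$, with the vague topology (a Polish space). A point process on $\mathbb{D}$ is a Borel probability measure $\mathbb{P}$ on $\mathrm{Conf}(\mathbb{D})$. For a Borel set $B\subset\mathbb{D}$, $\#B:X\mapsto X(B)=\int_B dX$. A bounded subset of $\mathbb{D}$ means a relatively compact subset of $\mathbb{D}$. Determinantal: $\mathbb{P}$ is the determinantal point process induced by the kernel $K:\mathbb{D}\times\mathbb{D}\to\mathbb{C}$ if for all $m\ge1$, all pairwise disjoint bounded Borel sets $B_1,\dots,B_m$ and all integers $n_1,\dots,n_m\ge1$ with $n_1+\dots+n_m=n$, $$\mathbb{E}_{\mathbb{P}}\Big[\prod_{i=1}^m\frac{(\#B_i)!}{(\#B_i-n_i)!}\Big]=\int_{B_1^{n_1}\times\cdots\times B_m^{n_m}}\det[K(x_i,x_j)]_{i,j=1}^n\,dm(x_1)\cdots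 dm(x_n),$$ where $\frac{N!}{(N-k)!}=N(N-1)\cdots(N-k+1)$. For each realization $\xi$, the kernel $K^{f_\xi}$ is the kernel of the orthogonal projection of $L^2(\mathbb{D},dm)$ onto the closed linear span of $\{z^n:\xi_n=1\}$ (almost surely infinite dimensional); this operator is locally of trace class, and it induces a unique determinantal point process. "Almost every realization" refers to the law of $\xi$; for a fixed realization, rigidity is a property of the point process induced by the (then deterministic) kernel. Number rigidity: for a Borel set $C\subset\mathbb{D}$ let $\mathcal{F}_C$ be the $\sigma$-algebra on $\mathrm{Conf}(\mathbb{D})$ generated by all $\#B$ with $B\subset C$ Borel, and let $\mathcal{F}_C^{\mathbb{P}}$ be its completion with respect to $\mathbb{P}$. A point process $\mathbb{P}$ on $\mathbb{D}$ is number rigid if for every bounded Borel set $B\subset\mathbb{D}$ the random variable $\#B$ is $\mathcal{F}_{\mathbb{D}\setminus B}^{\mathbb{P}}$-measurable. *)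

theory Defs
  imports "HOL-Probability.Probability" "Jordan_Normal_Form.Determinant"
begin

abbreviation unit_disc :: "complex set" where
  "unit_disc \<equiv> ball 0 1"

definition disc_borel :: "complex measure" where
  "disc_borel = restrict_space borel unit_disc"

definition disc_measure :: "complex measure" where
  "disc_measure = uniform_measure lborel unit_disc"

definition disc_bounded :: "complex set \<Rightarrow> bool" where
  "disc_bounded B \<longleftrightarrow> (\<exists>C. compact C \<and> C \<subseteq> unit_disc \<and> B \<subseteq> C)"

text \<open>On the disc (locally compact and second countable) every Borel measure that is finite on
  compact sets is Radon, so regularity is not listed separately.\<close>

definition Conf :: "complex measure set" where
  "Conf = {X. sets X = sets disc_borel
      \<and> (\<forall>C. compact C \<and> C \<subseteq> unit_disc \<longrightarrow> emeasure X C < \<infinity>)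
      \<and> (\<forall>B\<in>sets X. emeasure X B \<in> range of_nat \<union> {\<infinity>})}"

definition disc_Cc :: "(complex \<Rightarrow> real) set" where
  "disc_Cc = {f. continuous_on unit_disc f
      \<and> (\<exists>C. compact C \<and> C \<subseteq> unit_disc \<and> (\<forall>z\<in>unit_disc - C. f z = 0))}"

definition vague_topology :: "complex measure topology" where
  "vague_topology = topology_generated_by
     {{X \<in> Conf. (\<integral>z. f z \<partial>X) \<in> U} | f U. f \<in> disc_Cc \<and> open U}"

definition Conf_borel :: "complex measure measure" where
  "Conf_borel = sigma Conf {U. openin vague_topology U}"

definition point_process :: "complex measure measure \<Rightarrow> bool" where
  "point_process P \<longleftrightarrow> prob_space P \<and> sets P = sets Conf_borel"

definition falling_factorial :: "real \<Rightarrow> nat \<Rightarrow> real" where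
  "falling_factorial x k = (\<Prod>j<k. x - real j)"

text \<open>The list \<open>Bs\<close> below consists of \<open>n 0\<close> copies of \<open>B 0\<close>, then \<open>n 1\<close> copies of \<open>B 1\<close>, and
  so on, so that the domain of integration on the right is the product of the powers
  \<open>B i ^ n i\<close>. On the left, \<open>measure X (B i)\<close> is the number of points of \<open>X\<close> in \<open>B i\<close>; it is
  finite because \<open>B i\<close> is bounded. The integrability clauses exclude the convention that
  divergent integrals are zero.\<close>

definition determinantal ::
    "(complex \<Rightarrow> complex \<Rightarrow> complex) \<Rightarrow> complex measure measure \<Rightarrow> bool" where
  "determinantal K P \<longleftrightarrow>
    (\<forall>m::nat. \<forall>B :: nat \<Rightarrow> complex set. \<forall>n :: nat \<Rightarrow> nat.
      m \<ge> 1 \<longrightarrow>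
      (\<forall>i<m. B i \<in> sets disc_borel \<and> disc_bounded (B i)) \<longrightarrow>
      disjoint_family_on B {..<m} \<longrightarrow>
      (\<forall>i<m. n i \<ge> 1) \<longrightarrow>
      (let N = (\<Sum>i<m. n i);
           Bs = concat (map (\<lambda>i. replicate (n i) (B i)) [0..<m]);
           F = (\<lambda>X. \<Prod>i<m. falling_factorial (measure X (B i)) (n i));
           M = Pi\<^sub>M {..<N} (\<lambda>_. disc_measure);
           D = Pi\<^sub>E {..<N} (\<lambda>k. Bs ! k);
           G = (\<lambda>x. Determinant.det (Matrix.mat N N (\<lambda>(k, l). K (x k) (x l))))
       in integrable P F \<and> set_integrable M D G \<and>
          complex_of_real (\<integral>X. F X \<partial>P) = (\<integral>x\<in>D. G x \<partial>M)))"

definition count_algebra :: "complex set \<Rightarrow> complex measure measure" where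
  "count_algebra C = sigma Conf
     {{X \<in> Conf. emeasure X B \<in> A} | B A. B \<in> sets disc_borel \<and> B \<subseteq> C \<and> A \<in> sets borel}"

text \<open>The completion with respect to \<open>P\<close> adjoins all \<open>P\<close>-null sets of \<open>Conf\<close>. This is not the
  completion of the restriction of \<open>P\<close> to \<open>count_algebra C\<close>: every set of that
  \<open>\<sigma>\<close>-algebra depends only on the configuration in \<open>C\<close>, so a nonempty event saying that the
  count outside \<open>C\<close> differs from a given function of the configuration in \<open>C\<close> need not lie
  in a null set of it.\<close>

definition completed_count_algebra ::
    "complex measure measure \<Rightarrow> complex set \<Rightarrow> complex measure measure" where
  "completed_count_algebra P C =
     sigma Conf (sets (count_algebra C) \<union> null_sets (completion P))"

definition number_rigid :: "complex measure measure \<Rightarrow> bool" where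
  "number_rigid P \<longleftrightarrow> (\<forall>B\<in>sets disc_borel. disc_bounded B \<longrightarrow>
     (\<lambda>X. emeasure X B) \<in> borel_measurable (completed_count_algebra P (unit_disc - B)))"

definition weighted_kernel :: "(nat \<Rightarrow> real) \<Rightarrow> complex \<Rightarrow> complex \<Rightarrow> complex" where
  "weighted_kernel f z w = (\<Sum>n. of_real (f n) * of_nat (n + 1) * z ^ n * cnj w ^ n)"

end

theory Submission
  imports Defs
begin

text \<open>By the Ghosh--Peres criterion it suffices to find statistics of the point process that give weight
  one to every point of a large disc and whose variances tend to zero. For a radial kernel with coefficients
  \<open>\<xi>\<^sub>n \<in> {0, 1}\<close> the moduli of the points are distributed like independent variables, and the counts
  in the discs \<open>|z|\<^sup>2 \<le> p\<close> and \<open>|z|\<^sup>2 \<le> q\<close> with \<open>p \<le> q\<close> have covariance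
  \<open>\<Sum>n. \<xi>\<^sub>n p\<^bsup>n+1\<^esup> (1 - q\<^bsup>n+1\<^esup>)\<close>. Averaged over \<open>\<xi>\<close>, this is at most \<open>(1 - q) / (1 - p)\<close>, because
  \<open>1 - q\<^bsup>n+1\<^esup> \<le> (n + 1) (1 - q)\<close> cancels the probability \<open>1 / (n + 1)\<close>. Hence the counts
  in the discs \<open>|z|\<^sup>2 \<le> 1 - 2\<^bsup>-i\<^esup>\<close> are exponentially decorrelated in \<open>i\<close>, and their mean over
  \<open>2\<^sup>k\<close> consecutive values of \<open>i\<close> has expected variance of order \<open>2\<^bsup>-k\<^esup>\<close>. This is
  summable, so for almost every \<open>\<xi>\<close> the variances themselves are summable.\<close>

section \<open>Rotation invariance and radial sets\<close>

lemma nn_integral_lborel_translate: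
  fixes f :: "'a::euclidean_space \<Rightarrow> ennreal"
  assumes [measurable]: "f \<in> borel_measurable borel"
  shows "(\<integral>\<^sup>+x. f (c + x) \<partial>lborel) = (\<integral>\<^sup>+x. f x \<partial>lborel)"
proof -
  have "(\<integral>\<^sup>+x. f x \<partial>lborel) = (\<integral>\<^sup>+x. f x \<partial>distr lborel borel ((+) c))"
    by (simp add: lborel_distr_plus)
  also have "\<dots> = (\<integral>\<^sup>+x. f (c + x) \<partial>lborel)"
    by (subst nn_integral_distr) auto
  finally show ?thesis by simp
qed

text \<open>Both sides, multiplied by the area of the unit disc \<open>E\<close>, are the two iterated integrals of
  \<open>1\<^sub>A (u x) 1\<^sub>E (y - u x)\<close>.\<close>

lemma emeasure_lborel_rotation:
  fixes u :: complex
  assumes u: "norm u = 1" and A [measurable]: "A \<in> sets borel"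
  shows "emeasure lborel ((\<lambda>z. u * z) -` A) = emeasure lborel A"
proof -
  define E where "E = ball (0::complex) 1"
  have [measurable]: "E \<in> sets borel" by (simp add: E_def)
  let ?f = "\<lambda>x y. indicator A (u * x) * indicator E (y - u * x) :: ennreal"
  have u0: "u \<noteq> 0" using u by auto
  have meas: "(\<lambda>z. u * z) -` A \<in> sets borel"
    using measurable_sets[of "\<lambda>z. u * z" borel borel A] A by auto
  have E: "emeasure lborel E \<noteq> 0" "emeasure lborel E \<noteq> \<infinity>"
    by (simp_all add: E_def emeasure_ball unit_ball_vol_2)
  have "(\<integral>\<^sup>+x. \<integral>\<^sup>+y. ?f x y \<partial>lborel \<partial>lborel) = (\<integral>\<^sup>+x. indicator A (u * x) * emeasure lborel E \<partial>lborel)"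
  proof (rule nn_integral_cong)
    fix x
    have "(\<integral>\<^sup>+y. ?f x y \<partial>lborel) = indicator A (u * x) * (\<integral>\<^sup>+y. indicator E (- (u * x) + y) \<partial>lborel)"
    proof -
      have "(\<lambda>y. y - u * x) \<in> borel_measurable borel"
        by (intro borel_measurable_continuous_onI continuous_intros)
      moreover have "(indicator E :: complex \<Rightarrow> ennreal) \<in> borel_measurable borel"
        by (rule borel_measurable_indicator) simp
      ultimately have "(\<lambda>y. indicator E (y - u * x) :: ennreal) \<in> borel_measurable lborel"
        unfolding measurable_lborel2 by (rule measurable_compose)
      then show ?thesis
        by (simp only: nn_integral_cmult uminus_add_conv_diff)
    qed
    also have "\<dots> = indicator A (u * x) * emeasure lborel E"
      by (subst nn_integral_lborel_translate) auto
    finally show "(\<integral>\<^sup>+y. ?f x y \<partial>lborel) = indicator A (u * x) * emeasure lborel E" .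
  qed
  also have "\<dots> = emeasure lborel ((\<lambda>z. u * z) -` A) * emeasure lborel E"
    using meas by (subst nn_integral_multc)
      (auto simp flip: nn_integral_indicator simp: indicator_def intro!: nn_integral_cong)
  finally have lhs: "(\<integral>\<^sup>+x. \<integral>\<^sup>+y. ?f x y \<partial>lborel \<partial>lborel) = emeasure lborel ((\<lambda>z. u * z) -` A) * emeasure lborel E" .
  have "(\<integral>\<^sup>+y. \<integral>\<^sup>+x. ?f x y \<partial>lborel \<partial>lborel) = (\<integral>\<^sup>+y. \<integral>\<^sup>+x. indicator A (u * x + y) * indicator E x \<partial>lborel \<partial>lborel)"
  proof (rule nn_integral_cong)
    fix y
    \<comment> \<open>The shift by \<open>y / u\<close> turns \<open>u * x\<close> into
      \<open>u * x + y\<close> and \<open>y - u * x\<close> into \<open>- (u * x)\<close>, whose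
      membership in \<open>E\<close> depends on \<open>norm x\<close> alone. Integrating over
      \<open>y\<close> first then separates \<open>A\<close> from \<open>E\<close>.\<close>
    have "(\<integral>\<^sup>+x. ?f x y \<partial>lborel) = (\<integral>\<^sup>+x. ?f (y / u + x) y \<partial>lborel)"
      by (subst nn_integral_lborel_translate[where f = "\<lambda>x. ?f x y"]) auto
    also have "\<dots> = (\<integral>\<^sup>+x. indicator A (u * x + y) * indicator E x \<partial>lborel)"
    proof (rule nn_integral_cong)
      fix x
      have "u * (y / u + x) = u * x + y" using u0 by (simp add: field_simps)
      then show "?f (y / u + x) y = indicator A (u * x + y) * indicator E x"
        using u by (simp add: E_def indicator_def norm_mult)
    qed
    finally show "(\<integral>\<^sup>+x. ?f x y \<partial>lborel) = (\<integral>\<^sup>+x. indicator A (u * x + y) * indicator E x \<partial>lborel)" .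
  qed
  also have "\<dots> = (\<integral>\<^sup>+x. \<integral>\<^sup>+y. indicator A (u * x + y) * indicator E x \<partial>lborel \<partial>lborel)"
    by (rule lborel_pair.Fubini') measurable
  also have "\<dots> = (\<integral>\<^sup>+x. emeasure lborel A * indicator E x \<partial>lborel)"
    by (rule nn_integral_cong, subst nn_integral_multc, simp, subst nn_integral_lborel_translate) auto
  also have "\<dots> = emeasure lborel A * emeasure lborel E"
    by (subst nn_integral_cmult) auto
  finally have rhs: "(\<integral>\<^sup>+y. \<integral>\<^sup>+x. ?f x y \<partial>lborel \<partial>lborel) = emeasure lborel A * emeasure lborel E" .
  have "(\<integral>\<^sup>+y. \<integral>\<^sup>+x. ?f x y \<partial>lborel \<partial>lborel) = (\<integral>\<^sup>+x. \<integral>\<^sup>+y. ?f x y \<partial>lborel \<partial>lborel)"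
    by (rule lborel_pair.Fubini') measurable
  with lhs rhs have "emeasure lborel E * emeasure lborel ((\<lambda>z. u * z) -` A) = emeasure lborel E * emeasure lborel A"
    by (simp add: mult.commute)
  with E show ?thesis
    by (simp add: ennreal_mult_cancel_left)
qed

section \<open>The normalized area measure, its rotations and its radial part\<close>

lemma emeasure_unit_disc: "emeasure lborel unit_disc = ennreal pi"
  by (simp add: emeasure_ball unit_ball_vol_2)

lemma sets_disc_measure [simp, measurable_cong]: "sets disc_measure = sets borel"
  by (simp add: disc_measure_def)

lemma space_disc_measure [simp]: "space disc_measure = UNIV"
  by (simp add: disc_measure_def)

lemma prob_space_disc_measure: "prob_space disc_measure"
  unfolding disc_measure_def
  by (rule prob_space_uniform_measure) (simp_all add: emeasure_unit_disc)

interpretation disc: prob_space disc_measure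
  by (rule prob_space_disc_measure)

lemma disc_measure_distr_rotation:
  fixes u :: complex
  assumes u: "norm u = 1"
  shows "distr disc_measure borel (\<lambda>z. u * z) = disc_measure"
proof (rule measure_eqI)
  fix A :: "complex set"
  assume "A \<in> sets (distr disc_measure borel (\<lambda>z. u * z))"
  then have A [measurable]: "A \<in> sets borel" by simp
  have m: "(\<lambda>z. u * z) -` A \<in> sets borel"
    using measurable_sets[of "\<lambda>z. u * z" borel borel A] A by auto
  have "unit_disc \<inter> (\<lambda>z. u * z) -` A = (\<lambda>z. u * z) -` (unit_disc \<inter> A)"
    using u by (auto simp: norm_mult)
  then have "emeasure lborel (unit_disc \<inter> (\<lambda>z. u * z) -` A) = emeasure lborel (unit_disc \<inter> A)"
    using emeasure_lborel_rotation[OF u, of "unit_disc \<inter> A"] by simp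
  with m show "emeasure (distr disc_measure borel (\<lambda>z. u * z)) A = emeasure disc_measure A"
    by (subst emeasure_distr) (simp_all add: disc_measure_def del: vimage_Int)
qed simp

text \<open>Over such sets the monomials \<open>z ^ n\<close> are pairwise orthogonal, which
  diagonalizes the kernel and turns its integrals into sums over \<open>n\<close>.\<close>

definition radial :: "complex set \<Rightarrow> bool" where
  "radial A \<longleftrightarrow> A \<in> sets borel \<and> A \<subseteq> unit_disc \<and> (\<forall>u z. norm u = 1 \<longrightarrow> z \<in> A \<longrightarrow> u * z \<in> A)"

lemma radial_mult_iff: "radial A \<Longrightarrow> norm u = 1 \<Longrightarrow> u * z \<in> A \<longleftrightarrow> z \<in> A"
proof
  assume A: "radial A" and u: "norm u = 1" and z: "u * z \<in> A"
  have "norm (inverse u) = 1" using u by (simp add: norm_inverse)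
  then have "inverse u * (u * z) \<in> A"
    using A z unfolding radial_def by blast
  moreover have "inverse u * (u * z) = z"
    using u by (auto simp: field_simps)
  ultimately show "z \<in> A" by metis
qed (auto simp: radial_def)

lemma borel_measurable_cnj: "cnj \<in> borel_measurable borel"
  by (intro borel_measurable_continuous_onI continuous_intros)

lemma integrable_radial_monomial:
  assumes "radial A"
  shows "integrable disc_measure (\<lambda>z. indicator A z *\<^sub>R (z ^ n * cnj z ^ m))"
proof (rule disc.integrable_const_bound[where B = 1])
  have "A \<in> sets borel" using assms by (simp add: radial_def)
  then show "(\<lambda>z. indicator A z *\<^sub>R (z ^ n * cnj z ^ m)) \<in> borel_measurable disc_measure"
    using borel_measurable_cnj by measurable
  show "AE z in disc_measure. norm (indicator A z *\<^sub>R (z ^ n * cnj z ^ m)) \<le> 1"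
  proof (rule AE_I2)
    fix z
    have "A \<subseteq> unit_disc" using assms by (simp add: radial_def)
    then show "norm (indicator A z *\<^sub>R (z ^ n * cnj z ^ m)) \<le> 1"
      by (auto simp: indicator_def norm_mult norm_power intro!: mult_le_one power_le_one
          dest!: subsetD)
  qed
qed

text \<open>Rotation by a unimodular \<open>u\<close> preserves the measure and the set and
  multiplies the integrand by \<open>u ^ n * cnj u ^ m\<close>. The angle
  \<open>pi / (n - m)\<close> makes this factor \<open>-1\<close>, so the integral equals its own
  negative.\<close>

lemma integral_radial_monomial_eq_0:
  assumes A: "radial A" and nm: "n \<noteq> m"
  shows "(\<integral>z. indicator A z *\<^sub>R (z ^ n * cnj z ^ m) \<partial>disc_measure) = 0" (is "?I = 0")
proof -
  define k where "k = int n - int m"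
  have k0: "k \<noteq> 0" using nm by (simp add: k_def)
  define u where "u = cis (pi / k)"
  have nu: "norm u = 1" by (simp add: u_def)
  have [measurable]: "A \<in> sets borel" using A by (simp add: radial_def)
  have un: "u ^ n * cnj u ^ m = -1"
  proof -
    have "u ^ n * cnj u ^ m = cis (real n * (pi / k)) * cis (- (real m * (pi / k)))"
      by (simp only: u_def cis_cnj Complex.DeMoivre mult_minus_right)
    also have "\<dots> = cis ((real n - real m) * (pi / k))"
      by (simp add: cis_mult algebra_simps)
    also have "(real n - real m) * (pi / k) = pi"
      using k0 by (simp add: k_def)
    finally show ?thesis by simp
  qed
  note borel_measurable_cnj [measurable]
  have "?I = (\<integral>z. indicator A z *\<^sub>R (z ^ n * cnj z ^ m) \<partial>distr disc_measure borel (\<lambda>z. u * z))"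
    by (simp add: disc_measure_distr_rotation[OF nu])
  also have "\<dots> = (\<integral>z. indicator A (u * z) *\<^sub>R ((u * z) ^ n * cnj (u * z) ^ m) \<partial>disc_measure)"
    by (rule integral_distr) measurable
  also have "\<dots> = (\<integral>z. - (indicator A z *\<^sub>R (z ^ n * cnj z ^ m)) \<partial>disc_measure)"
  proof (rule Bochner_Integration.integral_cong)
    fix z
    have "(u * z) ^ n * cnj (u * z) ^ m = (u ^ n * cnj u ^ m) * (z ^ n * cnj z ^ m)"
      by (simp add: power_mult_distrib)
    then have "(u * z) ^ n * cnj (u * z) ^ m = - (z ^ n * cnj z ^ m)" by (simp add: un)
    moreover have "indicator A (u * z) = (indicator A z :: real)"
      using radial_mult_iff[OF A nu] by (simp add: indicator_def)
    ultimately show "indicator A (u * z) *\<^sub>R ((u * z) ^ n * cnj (u * z) ^ m) = - (indicator A z *\<^sub>R (z ^ n * cnj z ^ m))"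
      by simp
  qed simp
  also have "\<dots> = - ?I" by (rule integral_minus)
  finally show ?thesis by simp
qed

text \<open>The parameter is the squared radius because the squared modulus is uniformly distributed
  under \<open>disc_measure\<close>.\<close>

definition qdisc :: "real \<Rightarrow> complex set" where
  "qdisc q = {z. (norm z)\<^sup>2 \<le> q}"

lemma qdisc_eq_cball: "0 \<le> q \<Longrightarrow> qdisc q = cball 0 (sqrt q)"
  by (auto simp: qdisc_def real_le_rsqrt sqrt_ge_absD)

text \<open>For \<open>t\<close> in the unit interval the disc of squared radius \<open>t\<close>
  has normalized area \<open>t\<close>, so the distribution functions agree. This takes the place of
  polar coordinates: radial integrals become integrals over the unit interval.\<close>

lemma disc_distr_norm2: "distr disc_measure borel (\<lambda>z. (norm z)\<^sup>2) = uniform_measure lborel {0..1::real}"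
proof (rule cdf_unique)
  show "real_distribution (distr disc_measure borel (\<lambda>z. (norm z)\<^sup>2))"
    by (intro real_distribution.intro disc.prob_space_distr real_distribution_axioms.intro) auto
  show "real_distribution (uniform_measure lborel {0..1::real})"
    by (intro real_distribution.intro prob_space_uniform_measure real_distribution_axioms.intro) auto
  show "cdf (distr disc_measure borel (\<lambda>z. (norm z)\<^sup>2)) = cdf (uniform_measure lborel {0..1::real})"
  proof
    fix t :: real
    have "cdf (distr disc_measure borel (\<lambda>z. (norm z)\<^sup>2)) t = measure disc_measure (qdisc t)"
      by (simp add: cdf_def measure_distr vimage_def qdisc_def)
    also have "\<dots> = measure lborel (unit_disc \<inter> qdisc t) / pi"
      by (simp add: disc_measure_def measure_uniform_measure emeasure_unit_disc qdisc_def content_ball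
          unit_ball_vol_2)
    also have "\<dots> = measure lborel ({0..1} \<inter> {..t})"
    proof -
      consider "t < 0" | "0 \<le> t" "t < 1" | "1 \<le> t" by linarith
      then show ?thesis
      proof cases
        case 1
        then have "qdisc t = {}" "{0..1} \<inter> {..t} = {}"
          by (auto simp: qdisc_def not_le intro: less_le_trans)
        then show ?thesis by simp
      next
        case 2
        then have "sqrt t < 1" by simp
        then have "unit_disc \<inter> qdisc t = cball 0 (sqrt t)"
          using 2 \<open>sqrt t < 1\<close> by (auto simp: qdisc_eq_cball simp del: real_sqrt_lt_1_iff)
        moreover have "{0..1} \<inter> {..t} = {0..t}" using 2 by auto
        ultimately show ?thesis using 2 by (simp add: content_cball unit_ball_vol_2)
      next
        case 3
        have "unit_disc \<inter> qdisc t = unit_disc"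
          using 3 by (auto simp: qdisc_def intro: order_trans[OF power_le_one])
        moreover have "{0..1} \<inter> {..t} = {0..1}" using 3 by auto
        ultimately show ?thesis by (simp add: content_ball unit_ball_vol_2)
      qed
    qed
    also have "\<dots> = cdf (uniform_measure lborel {0..1::real}) t"
      by (simp add: cdf_def measure_uniform_measure)
    finally show "cdf (distr disc_measure borel (\<lambda>z. (norm z)\<^sup>2)) t = cdf (uniform_measure lborel {0..1::real}) t" .
  qed
qed

lemma integral_qdisc_norm_power:
  assumes q: "0 \<le> q" "q \<le> 1"
  shows "(\<integral>z. indicator (qdisc q) z * (norm z)\<^sup>2 ^ n \<partial>disc_measure) = q ^ Suc n / Suc n"
proof -
  have "(\<integral>z. indicator (qdisc q) z * (norm z)\<^sup>2 ^ n \<partial>disc_measure)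
      = (\<integral>z. indicator {..q} ((norm z)\<^sup>2) * (norm z)\<^sup>2 ^ n \<partial>disc_measure)"
    by (rule Bochner_Integration.integral_cong) (auto simp: qdisc_def indicator_def)
  also have "\<dots> = (\<integral>t. indicator {..q} t * t ^ n \<partial>distr disc_measure borel (\<lambda>z. (norm z)\<^sup>2))"
    by (subst integral_distr) auto
  also have "\<dots> = (\<integral>t. indicator {0..1} t *\<^sub>R (indicator {..q} t * t ^ n) \<partial>lborel)"
  proof -
    have "uniform_measure lborel {0..1::real} = density lborel (indicator {0..1})"
      unfolding uniform_measure_def by (rule density_cong) (auto simp: divide_ennreal_def)
    then have "uniform_measure lborel {0..1::real} = density lborel (\<lambda>t. ennreal (indicator {0..1} t))"
      by (simp add: ennreal_indicator)
    then show ?thesis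
      unfolding disc_distr_norm2 by (simp add: integral_density del: real_scaleR_def)
  qed
  also have "\<dots> = (\<integral>t. t ^ n * indicator {0..q} t \<partial>lborel)"
    using q by (intro Bochner_Integration.integral_cong) (auto simp: indicator_def)
  also have "\<dots> = q ^ Suc n / Suc n"
    using q integral_power[of 0 q n] by simp
  finally show ?thesis .
qed

section \<open>Integrals of the kernel over radial sets\<close>

text \<open>The weight \<open>(n + 1) * (norm z) ^ (2 * n)\<close> is a probability density, the
  squared modulus of the \<open>n\<close>-th orthonormal monomial. For radial \<open>A\<close> the
  value is the eigenvalue at \<open>z ^ n\<close> of the full Bergman kernel compressed to
  \<open>A\<close>.\<close>

definition mass :: "nat \<Rightarrow> complex set \<Rightarrow> real" where
  "mass n A = (n + 1) * (\<integral>z. indicator A z * (norm z)\<^sup>2 ^ n \<partial>disc_measure)"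

lemma integral_radial_monomial:
  assumes A: "radial A"
  shows "(\<integral>z. indicator A z *\<^sub>R (z ^ n * cnj z ^ m) \<partial>disc_measure) =
    (if n = m then of_real (mass n A / (n + 1)) else 0)"
proof (cases "n = m")
  case True
  have "indicator A z *\<^sub>R (z ^ n * cnj z ^ n) = complex_of_real (indicator A z * (norm z)\<^sup>2 ^ n)" for z
  proof -
    have "z ^ n * cnj z ^ n = complex_of_real ((norm z)\<^sup>2 ^ n)"
      unfolding power_mult_distrib[symmetric] complex_norm_square[symmetric] of_real_power[symmetric] by (rule refl)
    then show ?thesis by (simp add: scaleR_conv_of_real)
  qed
  then have "(\<integral>z. indicator A z *\<^sub>R (z ^ n * cnj z ^ n) \<partial>disc_measure)
      = of_real (\<integral>z. indicator A z * (norm z)\<^sup>2 ^ n \<partial>disc_measure)"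
    by (simp only: integral_complex_of_real)
  also have "(\<integral>z. indicator A z * (norm z)\<^sup>2 ^ n \<partial>disc_measure) = mass n A / (n + 1)"
    by (simp add: mass_def field_simps)
  finally show ?thesis
    using True by simp
qed (simp add: integral_radial_monomial_eq_0[OF A])

lemma det_mat_2: "Determinant.det (Matrix.mat 2 2 (\<lambda>(k, l). F k l)) = F 0 0 * F 1 1 - F 0 1 * F 1 (0::nat)"
  for F :: "nat \<Rightarrow> nat \<Rightarrow> 'b::comm_ring_1"
proof -
  let ?t = "Transposition.transpose 0 (1::nat)"
  have "id 0 \<noteq> ?t 0" by simp
  then have ne: "id \<noteq> ?t" by metis
  have set2: "{0..<2::nat} = {0, 1}" by auto
  have perms: "{p. p permutes {0, 1::nat}} = {id, ?t}"
    by (auto simp: permutes_doubleton_iff)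
  have sign: "sign ?t = - 1" by (simp add: sign_swap_id)
  let ?A = "Matrix.mat 2 2 (\<lambda>(k, l). F k l)"
  have "Determinant.det ?A = (\<Sum>p\<in>{id, ?t}. of_int (sign p) * (\<Prod>i\<in>{0, 1}. ?A $$ (i, p i)))"
    by (subst det_def'[of _ 2]) (simp_all only: set2 perms mat_carrier)
  also have "\<dots> = of_int (sign (id :: nat \<Rightarrow> nat)) * (\<Prod>i\<in>{0, 1}. ?A $$ (i, id i))
      + of_int (sign ?t) * (\<Prod>i\<in>{0, 1}. ?A $$ (i, ?t i))"
    using ne by (subst sum.insert) auto
  also have "(\<Prod>i\<in>{0, 1}. ?A $$ (i, id i)) = F 0 0 * F 1 1"
    by simp
  also have "(\<Prod>i\<in>{0, 1}. ?A $$ (i, ?t i)) = F 0 1 * F 1 0"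
    by simp
  finally show ?thesis
    unfolding sign by simp
qed

lemma disc_product: "product_sigma_finite (\<lambda>_. disc_measure)"
  by (intro product_sigma_finite.intro disc.sigma_finite_measure_axioms)

text \<open>Integrals are computed for these finite sums and then passed to the limit by dominated
  convergence.\<close>

definition kernel_trunc :: "(nat \<Rightarrow> real) \<Rightarrow> nat \<Rightarrow> complex \<Rightarrow> complex \<Rightarrow> complex" where
  "kernel_trunc x N z w = (\<Sum>n<N. of_real (x n) * of_nat (n + 1) * z ^ n * cnj w ^ n)"

text \<open>Coefficients in \<open>{0, 1}\<close> make the kernel a projection kernel, and
  \<open>q < 1\<close> keeps all points in a compact set on which a convergent series dominates
  it.\<close>

locale sub_bergman =
  fixes x :: "nat \<Rightarrow> real" and q :: real
  assumes x01: "x n = 0 \<or> x n = 1"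
    and q: "0 \<le> q" "q < 1"
begin

lemma kernel_term_bound:
  assumes "z \<in> qdisc q" "w \<in> qdisc q"
  shows "norm (of_real (x n) * of_nat (n + 1) * z ^ n * cnj w ^ n) \<le> real (Suc n) * q ^ n"
proof -
  have "norm z \<le> sqrt q" "norm w \<le> sqrt q"
    using assms by (auto simp: qdisc_def real_le_rsqrt)
  then have "norm z * norm w \<le> sqrt q * sqrt q"
    using q by (intro mult_mono) auto
  then have "norm z * norm w \<le> q" using q by simp
  then have "(norm z * norm w) ^ n \<le> q ^ n"
    by (intro power_mono) auto
  moreover have "\<bar>x n\<bar> \<le> 1" using x01[of n] by auto
  ultimately have "\<bar>x n\<bar> * (real (Suc n) * (norm z * norm w) ^ n) \<le> 1 * (real (Suc n) * q ^ n)"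
    by (intro mult_mono) auto
  moreover have "norm (of_real (x n) * of_nat (n + 1) * z ^ n * cnj w ^ n) = \<bar>x n\<bar> * (real (Suc n) * (norm z * norm w) ^ n)"
    by (simp add: norm_mult norm_power power_mult_distrib del: of_nat_Suc of_nat_add)
  ultimately show ?thesis by simp
qed

text \<open>The diagonal of the full Bergman kernel on the boundary circle of
  \<open>qdisc q\<close>, which bounds every truncation on that disc.\<close>

definition kernel_bound :: real where "kernel_bound = 1 / (1 - q)\<^sup>2"

lemma geometric_sums: "(\<lambda>n. real (Suc n) * q ^ n) sums kernel_bound"
  unfolding kernel_bound_def using geometric_deriv_sums[of q] q by simp

lemma
  assumes "z \<in> qdisc q" "w \<in> qdisc q"
  shows kernel_trunc_tendsto: "(\<lambda>N. kernel_trunc x N z w) \<longlonglongrightarrow> weighted_kernel x z w"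
    and kernel_trunc_bound: "norm (kernel_trunc x N z w) \<le> kernel_bound"
proof -
  have "summable (\<lambda>n. of_real (x n) * of_nat (n + 1) * z ^ n * cnj w ^ n)"
    by (rule summable_comparison_test'[OF sums_summable[OF geometric_sums] kernel_term_bound[OF assms]])
  then show "(\<lambda>N. kernel_trunc x N z w) \<longlonglongrightarrow> weighted_kernel x z w"
    unfolding kernel_trunc_def weighted_kernel_def by (rule summable_LIMSEQ)
  have "norm (kernel_trunc x N z w) \<le> (\<Sum>n<N. real (Suc n) * q ^ n)"
    unfolding kernel_trunc_def by (rule sum_norm_le) (rule kernel_term_bound[OF assms])
  also have "\<dots> \<le> kernel_bound"
    unfolding sums_unique[OF geometric_sums]
    by (rule sum_le_suminf[OF sums_summable[OF geometric_sums]]) (use q in auto)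
  finally show "norm (kernel_trunc x N z w) \<le> kernel_bound" .
qed

lemma borel_measurable_kernel_trunc [measurable]:
  assumes "f \<in> borel_measurable M" "g \<in> borel_measurable M"
  shows "(\<lambda>y. kernel_trunc x N (f y) (g y)) \<in> borel_measurable M"
proof -
  note borel_measurable_cnj [measurable] assms [measurable]
  show ?thesis unfolding kernel_trunc_def by measurable
qed

text \<open>The finite sums integrate term by term to masses, and \<open>kernel_bound\<close>
  dominates them uniformly in \<open>N\<close>. The series will be the expected count in
  \<open>A\<close>.\<close>

lemma
  assumes A: "radial A" "A \<subseteq> qdisc q"
  shows integral_kernel_diag: "(\<lambda>n. x n * mass n A) sums Re (\<integral>z. indicator A z *\<^sub>R weighted_kernel x z z \<partial>disc_measure)"
    and integrable_kernel_diag: "integrable disc_measure (\<lambda>z. indicator A z *\<^sub>R weighted_kernel x z z)"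
proof -
  let ?f = "\<lambda>N z. indicator A z *\<^sub>R kernel_trunc x N z z"
  have [measurable]: "A \<in> sets borel" using A by (simp add: radial_def)
  have lim: "(\<lambda>N. ?f N z) \<longlonglongrightarrow> indicator A z *\<^sub>R weighted_kernel x z z" for z
    using kernel_trunc_tendsto[of z z] A by (cases "z \<in> A") auto
  \<comment> \<open>Off \<open>A\<close> the left side is zero, so
    \<open>0 \<le> kernel_bound\<close> is required as well; the empty truncation at the origin
    supplies it.\<close>
  have bound: "norm (?f N z) \<le> kernel_bound" for N z
    using kernel_trunc_bound[of z z N] A order_trans[OF norm_ge_zero kernel_trunc_bound[of 0 0 0]] q
    by (cases "z \<in> A") (auto simp: qdisc_def)
  have meas: "(\<lambda>z. indicator A z *\<^sub>R weighted_kernel x z z) \<in> borel_measurable disc_measure"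
    by (rule borel_measurable_LIMSEQ_metric[OF _ lim]) measurable
  have "(\<lambda>N. \<integral>z. ?f N z \<partial>disc_measure) \<longlonglongrightarrow> (\<integral>z. indicator A z *\<^sub>R weighted_kernel x z z \<partial>disc_measure)"
    by (rule integral_dominated_convergence[where w = "\<lambda>_. kernel_bound", OF meas _ _ AE_I2[OF lim] AE_I2[OF bound]])
      simp_all
  moreover have "(\<integral>z. ?f N z \<partial>disc_measure) = of_real (\<Sum>n<N. x n * mass n A)" for N
  proof -
    have "?f N z = (\<Sum>n<N. of_real (x n) * of_nat (n + 1) * (indicator A z *\<^sub>R (z ^ n * cnj z ^ n)))" for z
      by (simp add: kernel_trunc_def scaleR_sum_right mult.assoc)
    then have "(\<integral>z. ?f N z \<partial>disc_measure) = (\<Sum>n<N. of_real (x n) * of_nat (n + 1) *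
        (\<integral>z. indicator A z *\<^sub>R (z ^ n * cnj z ^ n) \<partial>disc_measure))"
      using A by (simp only: Bochner_Integration.integral_sum integrable_mult_right integrable_radial_monomial
          integral_mult_right_zero)
    also have "\<dots> = (\<Sum>n<N. of_real (x n * mass n A))"
      using A by (simp only: integral_radial_monomial)
        (auto intro!: sum.cong simp del: of_nat_Suc of_nat_add simp: field_simps)
    finally show ?thesis by simp
  qed
  ultimately have "(\<lambda>N. Re (of_real (\<Sum>n<N. x n * mass n A))) \<longlonglongrightarrow> Re (\<integral>z. indicator A z *\<^sub>R weighted_kernel x z z \<partial>disc_measure)"
    by (intro tendsto_Re) simp
  then show "(\<lambda>n. x n * mass n A) sums Re (\<integral>z. indicator A z *\<^sub>R weighted_kernel x z z \<partial>disc_measure)"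
    by (simp add: sums_def)
  show "integrable disc_measure (\<lambda>z. indicator A z *\<^sub>R weighted_kernel x z z)"
    by (rule integrable_dominated_convergence[where w = "\<lambda>_. kernel_bound", OF meas _ _ AE_I2[OF lim] AE_I2[OF bound]])
      simp_all
qed

text \<open>The product of two truncated kernels is a double sum over \<open>n\<close> and
  \<open>m\<close>. Each term factorizes over the two coordinates, orthogonality removes the terms
  with \<open>n \<noteq> m\<close>, and the remaining factors are masses.\<close>

lemma integral_kernel_offdiag:
  assumes A: "radial A" "A \<subseteq> qdisc q" and A': "radial A'" "A' \<subseteq> qdisc q"
  defines "Q \<equiv> Pi\<^sub>M {..<2::nat} (\<lambda>_. disc_measure)"
  shows "(\<lambda>n. x n * mass n A * mass n A') sums Re (\<integral>y. (indicator A (y 0) * indicator A' (y 1)) *\<^sub>R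
            (weighted_kernel x (y 0) (y 1) * weighted_kernel x (y 1) (y 0)) \<partial>Q)" (is "_ sums Re ?I")
    and "integrable Q (\<lambda>y. (indicator A (y 0) * indicator A' (y 1)) *\<^sub>R
            (weighted_kernel x (y 0) (y 1) * weighted_kernel x (y 1) (y 0)))"
proof -
  interpret product_sigma_finite "\<lambda>_::nat. disc_measure" by (rule disc_product)
  interpret Q: prob_space Q
    unfolding Q_def by (rule prob_space_PiM) (rule prob_space_disc_measure)
  let ?f = "\<lambda>N y. (indicator A (y 0) * indicator A' (y (1::nat))) *\<^sub>R (kernel_trunc x N (y 0) (y 1) * kernel_trunc x N (y 1) (y 0))"
  let ?g = "\<lambda>y. (indicator A (y 0) * indicator A' (y (1::nat))) *\<^sub>R (weighted_kernel x (y 0) (y 1) * weighted_kernel x (y 1) (y 0))"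
  have [measurable]: "A \<in> sets borel" "A' \<in> sets borel" using A A' by (auto simp: radial_def)
  have [measurable]: "(\<lambda>y. y i) \<in> borel_measurable Q" if "i < 2" for i
  proof -
    have "(\<lambda>y. y i) \<in> measurable Q disc_measure"
      using that unfolding Q_def by (intro measurable_component_singleton) simp
    then show ?thesis by (simp add: measurable_cong_sets[OF refl sets_disc_measure])
  qed
  have [measurable]: "(\<lambda>y. y 0) \<in> borel_measurable Q" "(\<lambda>y. y (Suc 0)) \<in> borel_measurable Q" by auto
  have lim: "(\<lambda>N. ?f N y) \<longlonglongrightarrow> ?g y" for y
  proof (cases "y 0 \<in> A \<and> y 1 \<in> A'")
    case True
    then show ?thesis
      using A A' by (intro tendsto_intros kernel_trunc_tendsto) auto
  qed auto
  have C0: "0 \<le> kernel_bound"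
    using q by (simp add: kernel_bound_def)
  have bound: "norm (?f N y) \<le> kernel_bound * kernel_bound" for N y
  proof (cases "y 0 \<in> A \<and> y 1 \<in> A'")
    case True
    then show ?thesis
      using kernel_trunc_bound[of "y 0" "y 1" N] kernel_trunc_bound[of "y 1" "y 0" N] A A' C0
      by (auto simp: norm_mult intro!: mult_mono)
  qed (use C0 in auto)
  have measf: "?f N \<in> borel_measurable Q" for N
    by measurable
  have meas: "?g \<in> borel_measurable Q"
    by (rule borel_measurable_LIMSEQ_metric[OF measf lim])
  have conv: "(\<lambda>N. \<integral>y. ?f N y \<partial>Q) \<longlonglongrightarrow> ?I"
    by (rule integral_dominated_convergence[where w = "\<lambda>_. kernel_bound * kernel_bound", OF meas measf _ AE_I2[OF lim] AE_I2[OF bound]]) simp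
  show "integrable Q ?g"
    by (rule integrable_dominated_convergence[where w = "\<lambda>_. kernel_bound * kernel_bound", OF meas measf _ AE_I2[OF lim] AE_I2[OF bound]]) simp
  have "(\<integral>y. ?f N y \<partial>Q) = of_real (\<Sum>n<N. x n * mass n A * mass n A')" for N
  proof -
    define c :: "nat \<Rightarrow> complex" where "c n = of_real (x n) * of_nat (n + 1)" for n
    \<comment> \<open>Coordinate \<open>0\<close> receives \<open>z ^ n\<close> from the first
      kernel and \<open>cnj z ^ m\<close> from the second; in coordinate \<open>1\<close> the
      exponents are exchanged.\<close>
    define g where "g n m i = (\<lambda>z. indicator (if i = 0 then A else A') z *\<^sub>R
      (z ^ (if i = 0 then n else m) * cnj z ^ (if i = 0 then m else n)))" for n m :: nat and i :: nat
    have g_int: "integrable disc_measure (g n m i)" for n m i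
      using integrable_radial_monomial[of "if i = 0 then A else A'"] A A' unfolding g_def by auto
    have set2: "{..<2::nat} = {0, 1}" by auto
    have "?f N y = (\<Sum>n<N. \<Sum>m<N. c n * c m * (\<Prod>i<2. g n m i (y i)))" for y
      unfolding kernel_trunc_def sum_product scaleR_sum_right
      by (intro sum.cong refl) (simp add: set2 g_def c_def scaleR_conv_of_real)
    then have "(\<integral>y. ?f N y \<partial>Q) = (\<integral>y. (\<Sum>n<N. \<Sum>m<N. c n * c m * (\<Prod>i<2. g n m i (y i))) \<partial>Q)"
      by (simp only:)
    also have "\<dots> = (\<Sum>n<N. \<Sum>m<N. c n * c m * (\<integral>y. (\<Prod>i<2. g n m i (y i)) \<partial>Q))"
    proof -
      have "integrable Q (\<lambda>y. \<Prod>i<2. g n m i (y i))" for n m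
        unfolding Q_def by (rule product_integrable_prod) (auto intro: g_int)
      then show ?thesis
        by (simp only: Bochner_Integration.integral_sum Bochner_Integration.integrable_sum
            integrable_mult_right integral_mult_right_zero)
    qed
    also have "\<dots> = (\<Sum>n<N. \<Sum>m<N. if n = m then of_real (x n * mass n A * mass n A') else 0)"
    proof (intro sum.cong refl)
      fix n m
      have "(\<integral>y. (\<Prod>i<2. g n m i (y i)) \<partial>Q) = (\<Prod>i<2. integral\<^sup>L disc_measure (g n m i))"
        unfolding Q_def by (rule product_integral_prod) (auto simp: g_int)
      also have "\<dots> = (if n = m then of_real (mass n A / (n + 1)) * of_real (mass n A' / (n + 1)) else 0)"
        using A A' by (simp add: set2 g_def integral_radial_monomial)
      finally have prod: "(\<integral>y. (\<Prod>i<2. g n m i (y i)) \<partial>Q) =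
        (if n = m then of_real (mass n A / (n + 1)) * of_real (mass n A' / (n + 1)) else 0)" .
      have "c n * c n * (of_real (mass n A / (n + 1)) * of_real (mass n A' / (n + 1)))
          = of_real ((x n * x n) * ((real (n + 1) * (mass n A / (n + 1))) * (real (n + 1) * (mass n A' / (n + 1)))))"
        unfolding c_def by (simp only: of_real_mult of_real_of_nat_eq mult_ac)
      \<comment> \<open>Idempotence \<open>x n * x n = x n\<close> enters here, so that the
        coefficient appears only once in the series.\<close>
      also have "\<dots> = of_real (x n * mass n A * mass n A')"
        using x01[of n] by auto
      finally show "c n * c m * (\<integral>y. (\<Prod>i<2. g n m i (y i)) \<partial>Q) = (if n = m then of_real (x n * mass n A * mass n A') else 0)"
        unfolding prod by auto
    qed
    also have "\<dots> = of_real (\<Sum>n<N. x n * mass n A * mass n A')" by simp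
    finally show ?thesis .
  qed
  with conv have "(\<lambda>N. Re (of_real (\<Sum>n<N. x n * mass n A * mass n A'))) \<longlonglongrightarrow> Re ?I"
    by (intro tendsto_Re) simp
  then show "(\<lambda>n. x n * mass n A * mass n A') sums Re ?I"
    by (simp add: sums_def)
qed

end

section \<open>First and second factorial moments\<close>

lemma in_sets_disc_borel_iff: "A \<in> sets disc_borel \<longleftrightarrow> A \<in> sets borel \<and> A \<subseteq> unit_disc"
  unfolding disc_borel_def by (subst sets_restrict_space_iff) auto

lemma qdisc_subset_unit_disc: "q < 1 \<Longrightarrow> qdisc q \<subseteq> unit_disc"
proof
  fix z assume "q < 1" "z \<in> qdisc q"
  then have "(norm z)\<^sup>2 < 1" by (simp add: qdisc_def)
  then show "z \<in> unit_disc" by (simp add: abs_square_less_1)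
qed

lemma qdisc_mono: "q \<le> r \<Longrightarrow> qdisc q \<subseteq> qdisc r"
  by (auto simp: qdisc_def)

lemma compact_qdisc: "compact (qdisc q)"
proof (cases "0 \<le> q")
  case False
  then have "qdisc q = {}" by (auto simp: qdisc_def not_le intro: less_le_trans)
  then show ?thesis by simp
qed (simp add: qdisc_eq_cball)

lemma borel_qdisc [measurable]: "qdisc q \<in> sets borel"
  by (simp add: compact_qdisc compact_imp_closed)

lemma disc_bounded_qdisc: "q < 1 \<Longrightarrow> A \<subseteq> qdisc q \<Longrightarrow> disc_bounded A"
  unfolding disc_bounded_def using compact_qdisc qdisc_subset_unit_disc by blast

text \<open>On a nonempty compact subset of the disc the squared modulus attains its maximum, which
  lies below \<open>1\<close> and serves as \<open>q\<close>.\<close>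

lemma disc_bounded_imp_qdisc:
  assumes "disc_bounded B"
  obtains q where "q < 1" "B \<subseteq> qdisc q"
proof -
  obtain K where K: "compact K" "K \<subseteq> unit_disc" "B \<subseteq> K"
    using assms unfolding disc_bounded_def by blast
  show thesis
  proof (cases "K = {}")
    case True
    then show thesis using that[of 0] K by auto
  next
    case False
    have "continuous_on K (\<lambda>z. (norm z)\<^sup>2)" by (intro continuous_intros)
    from continuous_attains_sup[OF K(1) False this] obtain z
      where z: "z \<in> K" "\<forall>y\<in>K. (norm y)\<^sup>2 \<le> (norm z)\<^sup>2" by blast
    have "norm z < 1" using z K by auto
    then have "(norm z)\<^sup>2 < 1" by (simp add: abs_square_less_1)
    moreover have "B \<subseteq> qdisc ((norm z)\<^sup>2)" using z K by (auto simp: qdisc_def)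
    ultimately show thesis using that by blast
  qed
qed

lemma radial_qdisc: "q < 1 \<Longrightarrow> radial (qdisc q)"
proof -
  assume "q < 1"
  moreover have "u * z \<in> qdisc q" if "norm u = 1" "z \<in> qdisc q" for u z
    using that by (simp add: qdisc_def norm_mult)
  ultimately show ?thesis
    unfolding radial_def by (intro conjI allI impI borel_qdisc qdisc_subset_unit_disc)
qed

lemma radial_Diff: "radial A \<Longrightarrow> radial B \<Longrightarrow> radial (A - B)"
proof -
  assume A: "radial A" and B: "radial B"
  have "u * z \<in> A - B" if "norm u = 1" "z \<in> A - B" for u z
    using that radial_mult_iff[OF A that(1)] radial_mult_iff[OF B that(1)] by simp
  then show ?thesis
    using A B unfolding radial_def by blast
qed

lemma integrable_qdisc_norm_power: "q < 1 \<Longrightarrow> integrable disc_measure (\<lambda>z. indicator (qdisc q) z * (norm z)\<^sup>2 ^ n)"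
proof (rule disc.integrable_const_bound[where B = 1])
  assume "q < 1"
  then show "AE z in disc_measure. norm (indicator (qdisc q) z * (norm z)\<^sup>2 ^ n) \<le> 1"
    using qdisc_subset_unit_disc[of q]
    by (intro AE_I2) (auto simp: indicator_def intro!: power_le_one dest!: subsetD)
qed measurable

lemma mass_qdisc: "0 \<le> q \<Longrightarrow> q < 1 \<Longrightarrow> mass n (qdisc q) = q ^ Suc n"
  unfolding mass_def by (subst integral_qdisc_norm_power) (simp_all add: add.commute[of 1])

lemma mass_qdisc_Diff:
  assumes "0 \<le> p" "p \<le> q" "q < 1"
  shows "mass n (qdisc q - qdisc p) = q ^ Suc n - p ^ Suc n"
proof -
  have "(\<integral>z. indicator (qdisc q - qdisc p) z * (norm z)\<^sup>2 ^ n \<partial>disc_measure)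
    = (\<integral>z. indicator (qdisc q) z * (norm z)\<^sup>2 ^ n - indicator (qdisc p) z * (norm z)\<^sup>2 ^ n \<partial>disc_measure)"
    using qdisc_mono[OF assms(2)] by (intro Bochner_Integration.integral_cong) (auto simp: indicator_def)
  also have "\<dots> = (\<integral>z. indicator (qdisc q) z * (norm z)\<^sup>2 ^ n \<partial>disc_measure)
      - (\<integral>z. indicator (qdisc p) z * (norm z)\<^sup>2 ^ n \<partial>disc_measure)"
    using assms by (intro Bochner_Integration.integral_diff integrable_qdisc_norm_power) auto
  finally have "mass n (qdisc q - qdisc p) = mass n (qdisc q) - mass n (qdisc p)"
    by (simp add: mass_def right_diff_distrib)
  then show ?thesis using assms by (simp add: mass_qdisc)
qed

section \<open>Moments read off from the determinantal property\<close>

lemma lessThan_2: "{..<2::nat} = {0, 1}"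
  by auto

text \<open>The order \<open>N\<close>, the list \<open>Bs\<close> and the statistic
  \<open>F\<close> enter through equations, so that each instance can supply them in simplified
  form.\<close>

lemma determinantalD:
  assumes "determinantal K P" "m \<ge> 1" "\<And>i. i < m \<Longrightarrow> B i \<in> sets disc_borel \<and> disc_bounded (B i)"
    "disjoint_family_on B {..<m}" "\<And>i. i < m \<Longrightarrow> n i \<ge> 1"
    "N = (\<Sum>i<m. n i)" "Bs = concat (map (\<lambda>i. replicate (n i) (B i)) [0..<m])"
    "F = (\<lambda>X. \<Prod>i<m. falling_factorial (measure X (B i)) (n i))"
  shows "integrable P F"
    and "complex_of_real (\<integral>X. F X \<partial>P) = (\<integral>y\<in>Pi\<^sub>E {..<N} (\<lambda>k. Bs ! k).
      Determinant.det (Matrix.mat N N (\<lambda>(k, l). K (y k) (y l))) \<partial>Pi\<^sub>M {..<N} (\<lambda>_. disc_measure))"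
  using assms(1)[unfolded determinantal_def, rule_format, of m B n] assms(2-5)
  unfolding Let_def assms(6-8) by blast+

text \<open>One set with multiplicity one: the determinant is a single diagonal entry and the
  product measure has a single coordinate.\<close>

lemma determinantal_moment1:
  assumes "determinantal K P" "A \<in> sets disc_borel" "disc_bounded A"
    "integrable disc_measure (\<lambda>z. indicator A z *\<^sub>R K z z)"
  shows "integrable P (\<lambda>X. measure X A)"
    and "complex_of_real (\<integral>X. measure X A \<partial>P) = (\<integral>z. indicator A z *\<^sub>R K z z \<partial>disc_measure)"
proof -
  interpret product_sigma_finite "\<lambda>_::nat. disc_measure" by (rule disc_product)
  let ?Q = "Pi\<^sub>M {..<1::nat} (\<lambda>_. disc_measure)"
  have [measurable]: "A \<in> sets borel" using assms by (simp add: in_sets_disc_borel_iff)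
  have det1: "Determinant.det (Matrix.mat (Suc 0) (Suc 0) (\<lambda>(k, l). K (y k) (y l))) = K (y 0) (y 0)" for y :: "nat \<Rightarrow> complex"
    by (subst det_single) auto
  note * = determinantalD[OF assms(1), of 1 "\<lambda>_. A" "\<lambda>_. 1" 1 "[A]" "\<lambda>X. measure X A"]
  show "integrable P (\<lambda>X. measure X A)"
    by (rule *) (use assms(2,3) in \<open>auto simp: disjoint_family_on_def falling_factorial_def\<close>)
  have "complex_of_real (\<integral>X. measure X A \<partial>P) = (\<integral>y\<in>Pi\<^sub>E {..<1} (\<lambda>k. [A] ! k).
      Determinant.det (Matrix.mat 1 1 (\<lambda>(k, l). K (y k) (y l))) \<partial>?Q)"
    by (rule *) (use assms(2,3) in \<open>auto simp: disjoint_family_on_def falling_factorial_def\<close>)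
  also have "\<dots> = (\<integral>y\<in>Pi\<^sub>E {..<1} (\<lambda>k. [A] ! k). K (y 0) (y 0) \<partial>?Q)"
    by (simp add: det1)
  also have "\<dots> = (\<integral>y. indicator A (y 0) *\<^sub>R K (y 0) (y 0) \<partial>?Q)"
    unfolding set_lebesgue_integral_def
    by (rule Bochner_Integration.integral_cong) (auto simp: space_PiM PiE_iff lessThan_Suc indicator_def)
  also have "\<dots> = (\<integral>z. indicator A z *\<^sub>R K z z \<partial>disc_measure)"
    using product_integral_prod[of "{..<1::nat}" "\<lambda>_ z. indicator A z *\<^sub>R K z z"] assms(4)
    by (simp add: lessThan_Suc)
  finally show "complex_of_real (\<integral>X. measure X A \<partial>P) = (\<integral>z. indicator A z *\<^sub>R K z z \<partial>disc_measure)" .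
qed

text \<open>Two disjoint sets with multiplicity one and one set with multiplicity two lead to the
  same integral of a two-by-two determinant, so both cases share \<open>I\<close>.\<close>

lemma determinantal_moment2:
  fixes K :: "complex \<Rightarrow> complex \<Rightarrow> complex" and A A' :: "complex set"
  defines "I \<equiv> (\<integral>y. (indicator A (y 0) * indicator A' (y 1)) *\<^sub>R
    (K (y 0) (y 0) * K (y 1) (y 1) - K (y 0) (y 1) * K (y 1) (y 0)) \<partial>Pi\<^sub>M {..<2::nat} (\<lambda>_. disc_measure))"
  assumes "determinantal K P" "A \<in> sets disc_borel" "disc_bounded A" "A' \<in> sets disc_borel" "disc_bounded A'"
  shows "A \<inter> A' = {} \<Longrightarrow> integrable P (\<lambda>X. measure X A * measure X A')"
    and "A \<inter> A' = {} \<Longrightarrow> complex_of_real (\<integral>X. measure X A * measure X A' \<partial>P) = I"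
    and "A = A' \<Longrightarrow> integrable P (\<lambda>X. measure X A * (measure X A - 1))"
    and "A = A' \<Longrightarrow> complex_of_real (\<integral>X. measure X A * (measure X A - 1) \<partial>P) = I"
proof -
  let ?Q = "Pi\<^sub>M {..<2::nat} (\<lambda>_. disc_measure)"
  have I: "(\<integral>y\<in>Pi\<^sub>E {..<2} (\<lambda>k. [A, A'] ! k). (K (y 0) (y 0) * K (y 1) (y 1) - K (y 0) (y 1) * K (y 1) (y 0)) \<partial>?Q) = I"
    unfolding set_lebesgue_integral_def I_def
    by (rule Bochner_Integration.integral_cong) (auto simp: space_PiM PiE_iff lessThan_2 indicator_def)
  {
    assume disj: "A \<inter> A' = {}"
    note * = determinantalD[OF assms(2), of 2 "\<lambda>i. if i = 0 then A else A'" "\<lambda>_. 1" 2 "[A, A']"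
        "\<lambda>X. measure X A * measure X A'", unfolded det_mat_2 I]
    have c: "[A, A'] = concat (map (\<lambda>i. replicate 1 (if i = 0 then A else A')) [0..<2])"
      by (simp add: numeral_2_eq_2)
    have d: "disjoint_family_on (\<lambda>i::nat. if i = 0 then A else A') {..<2}"
      using disj by (auto simp: disjoint_family_on_def)
    have f: "(\<lambda>X. measure X A * measure X A') = (\<lambda>X. \<Prod>i<2::nat. falling_factorial (measure X (if i = 0 then A else A')) 1)"
      by (simp add: lessThan_2 falling_factorial_def)
    show "integrable P (\<lambda>X. measure X A * measure X A')"
      by (rule *(1)[OF _ _ d _ _ c f]) (use assms(3-) in auto)
    show "complex_of_real (\<integral>X. measure X A * measure X A' \<partial>P) = I"
      by (rule *(2)[OF _ _ d _ _ c f]) (use assms(3-) in auto)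
  }
  {
    assume eq: "A = A'"
    note * = determinantalD[OF assms(2), of 1 "\<lambda>_. A" "\<lambda>_. 2" 2 "[A, A']"
        "\<lambda>X. measure X A * (measure X A - 1)", unfolded det_mat_2 I]
    have c: "[A, A'] = concat (map (\<lambda>i. replicate 2 A) [0..<1])"
      by (simp add: numeral_2_eq_2 eq)
    have d: "disjoint_family_on (\<lambda>i::nat. A) {..<1}"
      by (auto simp: disjoint_family_on_def)
    have f: "(\<lambda>X. measure X A * (measure X A - 1)) = (\<lambda>X. \<Prod>i<1::nat. falling_factorial (measure X A) 2)"
      by (simp add: lessThan_2 falling_factorial_def)
    show "integrable P (\<lambda>X. measure X A * (measure X A - 1))"
      by (rule *(1)[OF _ _ d _ _ c f]) (use assms(3-) in auto)
    show "complex_of_real (\<integral>X. measure X A * (measure X A - 1) \<partial>P) = I"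
      by (rule *(2)[OF _ _ d _ _ c f]) (use assms(3-) in auto)
  }
qed

section \<open>Covariance of the counts in two concentric discs\<close>

lemma point_process_prob_space: "point_process P \<Longrightarrow> prob_space P"
  by (simp add: point_process_def)

lemma point_process_space: "point_process P \<Longrightarrow> space P = Conf"
proof -
  assume "point_process P"
  then have "sets P = sets Conf_borel" by (simp add: point_process_def)
  then have "space P = space Conf_borel" by (rule sets_eq_imp_space_eq)
  then show ?thesis by (simp add: Conf_borel_def space_measure_of_conv)
qed

lemma Conf_sets: "X \<in> Conf \<Longrightarrow> sets X = sets disc_borel"
  by (simp add: Conf_def)

lemma Conf_emeasure_finite:
  assumes "X \<in> Conf" "A \<in> sets disc_borel" "disc_bounded A"
  shows "emeasure X A < \<infinity>"
proof -
  obtain K where K: "compact K" "K \<subseteq> unit_disc" "A \<subseteq> K"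
    using assms(3) unfolding disc_bounded_def by blast
  have "K \<in> sets X"
    using K by (simp add: Conf_sets[OF assms(1)] in_sets_disc_borel_iff borel_compact)
  then have "emeasure X A \<le> emeasure X K"
    using K by (intro emeasure_mono) auto
  also have "\<dots> < \<infinity>" using assms(1) K by (simp add: Conf_def)
  finally show ?thesis .
qed

lemma Conf_measure_Diff:
  assumes "X \<in> Conf" "A \<in> sets disc_borel" "disc_bounded A" "B \<in> sets disc_borel" "B \<subseteq> A"
  shows "measure X (A - B) = measure X A - measure X B"
proof -
  have "disc_bounded B" using assms(3,5) unfolding disc_bounded_def by blast
  then show ?thesis
    using assms Conf_emeasure_finite[OF assms(1-3)] Conf_emeasure_finite[of X B]
    by (intro measure_Diff) (auto simp: Conf_sets)
qed

context sub_bergman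
begin

context
  fixes P assumes P: "point_process P" "determinantal (weighted_kernel x) P"
begin

lemma radial_sets: "radial A \<Longrightarrow> A \<subseteq> qdisc q \<Longrightarrow> A \<in> sets disc_borel \<and> disc_bounded A"
  using q disc_bounded_qdisc[of q A] by (auto simp: in_sets_disc_borel_iff radial_def)

lemma
  assumes A: "radial A" "A \<subseteq> qdisc q"
  shows integrable_count: "integrable P (\<lambda>X. measure X A)"
    and kernel_diag_eq: "(\<integral>z. indicator A z *\<^sub>R weighted_kernel x z z \<partial>disc_measure) = of_real (\<integral>X. measure X A \<partial>P)"
    and expectation_count: "(\<lambda>n. x n * mass n A) sums (\<integral>X. measure X A \<partial>P)"
proof -
  note * = determinantal_moment1[OF P(2) conjunct1[OF radial_sets[OF A]] conjunct2[OF radial_sets[OF A]]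
      integrable_kernel_diag[OF A]]
  show "integrable P (\<lambda>X. measure X A)" by (rule *)
  show **: "(\<integral>z. indicator A z *\<^sub>R weighted_kernel x z z \<partial>disc_measure) = of_real (\<integral>X. measure X A \<partial>P)"
    by (rule *(2)[symmetric])
  \<comment> \<open>The first moment identity shows that the kernel integral is real, so taking
    \<open>Re\<close> changes nothing.\<close>
  show "(\<lambda>n. x n * mass n A) sums (\<integral>X. measure X A \<partial>P)"
    using integral_kernel_diag[OF A] unfolding ** by simp
qed

text \<open>\<open>M\<close> stands for either kind of second factorial moment. The diagonal product
  in the determinant factorizes into the two expectations, which leaves the off-diagonal integral as
  their product minus \<open>M\<close>.\<close>

lemma integral_kernel_det:
  assumes A: "radial A" "A \<subseteq> qdisc q" and A': "radial A'" "A' \<subseteq> qdisc q"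
    and M: "complex_of_real M = (\<integral>y. (indicator A (y 0) * indicator A' (y 1)) *\<^sub>R
    (weighted_kernel x (y 0) (y 0) * weighted_kernel x (y 1) (y 1) - weighted_kernel x (y 0) (y 1) * weighted_kernel x (y 1) (y 0))
       \<partial>Pi\<^sub>M {..<2::nat} (\<lambda>_. disc_measure))" (is "_ = ?I")
  shows "(\<lambda>n. x n * mass n A * mass n A') sums ((\<integral>X. measure X A \<partial>P) * (\<integral>X. measure X A' \<partial>P) - M)"
proof -
  interpret product_sigma_finite "\<lambda>_::nat. disc_measure" by (rule disc_product)
  let ?Q = "Pi\<^sub>M {..<2::nat} (\<lambda>_. disc_measure)"
  define g where "g i = (\<lambda>z. indicator (if i = 0 then A else A') z *\<^sub>R weighted_kernel x z z)" for i :: nat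
  have g: "integrable disc_measure (g i)" for i
    using integrable_kernel_diag A A' by (simp add: g_def)
  have g_eq: "(\<Prod>i<2. g i (y i)) = (indicator A (y 0) * indicator A' (y 1)) *\<^sub>R
    (weighted_kernel x (y 0) (y 0) * weighted_kernel x (y 1) (y 1))" for y
    by (simp add: lessThan_2 g_def scaleR_conv_of_real)
  let ?J = "\<integral>y. (indicator A (y 0) * indicator A' (y 1)) *\<^sub>R
            (weighted_kernel x (y 0) (y 1) * weighted_kernel x (y 1) (y 0)) \<partial>?Q"
  have "?I = (\<integral>y. (\<Prod>i<2. g i (y i)) - (indicator A (y 0) * indicator A' (y 1)) *\<^sub>R
            (weighted_kernel x (y 0) (y 1) * weighted_kernel x (y 1) (y 0)) \<partial>?Q)"
    unfolding g_eq by (simp only: scaleR_diff_right)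
  also have "\<dots> = (\<integral>y. (\<Prod>i<2. g i (y i)) \<partial>?Q) - ?J"
    using integral_kernel_offdiag(2)[OF A A'] g
    by (intro Bochner_Integration.integral_diff product_integrable_prod) auto
  also have "(\<integral>y. (\<Prod>i<2. g i (y i)) \<partial>?Q) = (\<Prod>i<2. integral\<^sup>L disc_measure (g i))"
    by (rule product_integral_prod) (auto simp: g)
  also have "\<dots> = of_real (\<integral>X. measure X A \<partial>P) * of_real (\<integral>X. measure X A' \<partial>P)"
    using A A' by (simp add: lessThan_2 g_def kernel_diag_eq)
  finally have "?J = of_real (\<integral>X. measure X A \<partial>P) * of_real (\<integral>X. measure X A' \<partial>P) - of_real M"
    using M by (simp add: algebra_simps)
  then have "Re ?J = (\<integral>X. measure X A \<partial>P) * (\<integral>X. measure X A' \<partial>P) - M"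
    by simp
  then show ?thesis
    using integral_kernel_offdiag(1)[OF A A'] by simp
qed

text \<open>The factorial moments are available for disjoint sets and for a single set, so the
  larger disc is split into the smaller disc \<open>A\<close> and the annulus \<open>D\<close>. The
  covariance is then the variance of the count in \<open>A\<close> plus its covariance with the
  count in \<open>D\<close>.\<close>

lemma count_covariance:
  assumes p: "0 \<le> p" "p \<le> q"
  defines "Np \<equiv> \<lambda>X. measure X (qdisc p) - (\<integral>X. measure X (qdisc p) \<partial>P)"
    and "Nq \<equiv> \<lambda>X. measure X (qdisc q) - (\<integral>X. measure X (qdisc q) \<partial>P)"
  shows "integrable P (\<lambda>X. Np X * Nq X)"
    and "(\<lambda>n. x n * p ^ Suc n * (1 - q ^ Suc n)) sums (\<integral>X. Np X * Nq X \<partial>P)"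
proof -
  interpret P: prob_space P by (rule point_process_prob_space[OF P(1)])
  have sp: "space P = Conf" by (rule point_process_space[OF P(1)])
  define A where "A = qdisc p"
  define D where "D = qdisc q - qdisc p"
  have A: "radial A" "A \<subseteq> qdisc q" using p q by (auto simp: A_def radial_qdisc qdisc_mono)
  have D: "radial D" "D \<subseteq> qdisc q" using p q by (auto simp: D_def radial_qdisc radial_Diff)
  have AD: "A \<inter> D = {}" by (auto simp: A_def D_def)
  note sA = radial_sets[OF A, THEN conjunct1] radial_sets[OF A, THEN conjunct2]
  note sD = radial_sets[OF D, THEN conjunct1] radial_sets[OF D, THEN conjunct2]
  define eA where "eA = (\<integral>X. measure X A \<partial>P)"
  define eD where "eD = (\<integral>X. measure X D \<partial>P)"
  have Nq: "measure X (qdisc q) = measure X A + measure X D" if "X \<in> space P" for X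
    using that sp Conf_measure_Diff[of X "qdisc q" A] radial_sets[OF radial_qdisc[of q]] q A sA
    by (auto simp: A_def D_def)
  have intA: "integrable P (\<lambda>X. measure X A)" and intD: "integrable P (\<lambda>X. measure X D)"
    using integrable_count A D by auto
  have eq: "(\<integral>X. measure X (qdisc q) \<partial>P) = eA + eD"
    unfolding eA_def eD_def Bochner_Integration.integral_add[OF intA intD, symmetric]
    by (rule Bochner_Integration.integral_cong) (auto simp: Nq)
  note mAD = determinantal_moment2(1,2)[OF P(2) sA sD AD]
  note mAA = determinantal_moment2(3,4)[OF P(2) sA sA refl]
  \<comment> \<open>The centred product is expanded in factorial moments; the \<open>1\<close> in
    the coefficient of \<open>measure X A\<close> comes from writing a square as
    \<open>a * (a - 1) + a\<close>.\<close>
  have NN: "Np X * Nq X = measure X A * (measure X A - 1) + measure X A * measure X D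
      + (1 - 2 * eA - eD) * measure X A - eA * measure X D + eA * (eA + eD)" if "X \<in> space P" for X
    using Nq[OF that] unfolding Np_def Nq_def eq by (simp add: A_def[symmetric] eA_def[symmetric] algebra_simps)
  have int: "integrable P (\<lambda>X. measure X A * (measure X A - 1) + measure X A * measure X D
      + (1 - 2 * eA - eD) * measure X A - eA * measure X D + eA * (eA + eD))"
    using mAD(1) mAA(1) intA intD by simp
  then show "integrable P (\<lambda>X. Np X * Nq X)"
    by (rule Bochner_Integration.integrable_cong[THEN iffD1, rotated -1]) (auto simp: NN)
  have "(\<integral>X. Np X * Nq X \<partial>P) = (\<integral>X. measure X A * (measure X A - 1) + measure X A * measure X D
      + (1 - 2 * eA - eD) * measure X A - eA * measure X D + eA * (eA + eD) \<partial>P)"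
    by (rule Bochner_Integration.integral_cong) (auto simp: NN)
  also have "\<dots> = (\<integral>X. measure X A * (measure X A - 1) \<partial>P) + (\<integral>X. measure X A * measure X D \<partial>P)
      + (1 - 2 * eA - eD) * eA - eA * eD + eA * (eA + eD)"
    using mAD(1) mAA(1) intA intD by (simp add: eA_def eD_def P.prob_space)
  finally have cov: "(\<integral>X. Np X * Nq X \<partial>P) = eA - (eA * eA - (\<integral>X. measure X A * (measure X A - 1) \<partial>P))
      - (eA * eD - (\<integral>X. measure X A * measure X D \<partial>P))"
    by (simp add: algebra_simps)
  have "(\<lambda>n. x n * mass n A - x n * mass n A * mass n A - x n * mass n A * mass n D) sums (\<integral>X. Np X * Nq X \<partial>P)"
    unfolding cov eA_def eD_def
    by (intro sums_diff expectation_count integral_kernel_det A D mAD(2) mAA(2))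
  \<comment> \<open>With \<open>a = p ^ Suc n\<close> and \<open>d = q ^ Suc n - a\<close> this is
    \<open>a - a * a - a * d = a * (1 - (a + d))\<close>.\<close>
  moreover have "x n * mass n A - x n * mass n A * mass n A - x n * mass n A * mass n D = x n * p ^ Suc n * (1 - q ^ Suc n)" for n
    using p q by (simp add: A_def D_def mass_qdisc mass_qdisc_Diff algebra_simps)
  ultimately show "(\<lambda>n. x n * p ^ Suc n * (1 - q ^ Suc n)) sums (\<integral>X. Np X * Nq X \<partial>P)"
    by simp
qed

end

end

section \<open>A criterion for number rigidity\<close>

lemma count_algebra_generators: "{{X \<in> Conf. emeasure X B \<in> A} | B A. B \<in> sets disc_borel \<and> B \<subseteq> C \<and> A \<in> sets borel} \<subseteq> Pow Conf"
  by auto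

lemma sets_count_algebra_subset: "sets (count_algebra C) \<subseteq> Pow Conf"
  using sets.space_closed[of "count_algebra C"]
  by (simp add: count_algebra_def space_measure_of_conv)

context
  fixes P assumes P: "point_process P"
begin

lemma completed_generators: "sets (count_algebra C) \<union> null_sets (completion P) \<subseteq> Pow Conf"
proof -
  have "null_sets (completion P) \<subseteq> Pow (space P)"
    using sets.sets_into_space[of _ "completion P"] by (auto simp: null_sets_def)
  then show ?thesis
    using sets_count_algebra_subset point_process_space[OF P] by auto
qed

lemma space_completed [simp]: "space (completed_count_algebra P C) = Conf"
  by (simp add: completed_count_algebra_def space_measure_of_conv)

lemma null_sets_in_completed: "N \<in> null_sets (completion P) \<Longrightarrow> N \<in> sets (completed_count_algebra P C)"
  unfolding completed_count_algebra_def by (subst sets_measure_of[OF completed_generators]) auto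

lemma count_measurable_completed:
  assumes "B \<in> sets disc_borel" "B \<subseteq> C"
  shows "(\<lambda>X. emeasure X B) \<in> borel_measurable (completed_count_algebra P C)"
proof (rule measurableI)
  fix A :: "ennreal set" assume A: "A \<in> sets borel"
  have "{X \<in> Conf. emeasure X B \<in> A} \<in> sets (count_algebra C)"
    unfolding count_algebra_def using assms A
    by (subst sets_measure_of[OF count_algebra_generators]) auto
  then have "{X \<in> Conf. emeasure X B \<in> A} \<in> sets (completed_count_algebra P C)"
    unfolding completed_count_algebra_def by (subst sets_measure_of[OF completed_generators]) auto
  moreover have "(\<lambda>X. emeasure X B) -` A \<inter> Conf = {X \<in> Conf. emeasure X B \<in> A}" by auto
  ultimately show "(\<lambda>X. emeasure X B) -` A \<inter> space (completed_count_algebra P C) \<in> sets (completed_count_algebra P C)"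
    by simp
qed simp

text \<open>Preimages under \<open>f\<close> and \<open>g\<close> differ only inside a
  \<open>P\<close>-null set, and the completed algebra contains every subset of such a set.\<close>

lemma completed_measurable_AE_eq:
  fixes f g :: "complex measure \<Rightarrow> ennreal"
  assumes f: "f \<in> borel_measurable (completed_count_algebra P C)"
    and ae: "AE X in P. f X = g X"
  shows "g \<in> borel_measurable (completed_count_algebra P C)"
proof (rule measurableI)
  let ?Q = "completed_count_algebra P C"
  obtain N where N: "N \<in> null_sets P" "{X \<in> space P. f X \<noteq> g X} \<subseteq> N"
    using ae by (rule AE_E) (blast intro: null_setsI)
  have sub: "S \<in> sets ?Q" if "S \<subseteq> N" for S
  proof -
    have "S \<in> null_sets (completion P)"
      by (rule null_sets_completion_subset[OF that null_sets_completionI[OF N(1)]])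
    then show ?thesis by (rule null_sets_in_completed)
  qed
  have eq: "X \<in> N" if "X \<in> Conf" "f X \<noteq> g X" for X
    using N that point_process_space[OF P] by auto
  fix A :: "ennreal set" assume "A \<in> sets borel"
  then have 1: "f -` A \<inter> Conf \<in> sets ?Q" using measurable_sets[OF f] by simp
  have split: "g -` A \<inter> Conf = (f -` A \<inter> Conf - {X \<in> Conf. f X \<noteq> g X}) \<union> (g -` A \<inter> {X \<in> Conf. f X \<noteq> g X})"
    by auto
  show "g -` A \<inter> space ?Q \<in> sets ?Q"
    unfolding space_completed split by (intro sets.Un sets.Diff 1 sub) (use eq in auto)
qed simp

text \<open>The averaged statistic gives weight one to every point of \<open>B\<close> once \<open>k\<close> is large, so the part of it
  that is carried by the complement of \<open>B\<close> determines the count in \<open>B\<close> up to an error tending to zero.\<close>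

lemma number_rigidI:
  fixes r :: "nat \<Rightarrow> real" and I :: "nat \<Rightarrow> nat set" and c :: "nat \<Rightarrow> real"
  assumes r: "\<And>i. r i < 1" "r \<longlonglongrightarrow> 1"
    and I: "\<And>k i. i \<in> I k \<Longrightarrow> k \<le> i" "\<And>k. finite (I k)" "\<And>k. I k \<noteq> {}"
    and conv: "AE X in P. (\<lambda>k. (\<Sum>i\<in>I k. measure X (qdisc (r i))) / card (I k) - c k) \<longlonglongrightarrow> 0"
  shows "number_rigid P"
  unfolding number_rigid_def
proof (intro ballI impI)
  fix B assume B: "B \<in> sets disc_borel" "disc_bounded B"
  let ?Q = "completed_count_algebra P (unit_disc - B)"
  obtain q where q: "q < 1" "B \<subseteq> qdisc q" using disc_bounded_imp_qdisc[OF B(2)] .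
  have "eventually (\<lambda>i. q < r i) sequentially" using r(2) q(1) by (rule order_tendstoD)
  then obtain k0 where k0: "\<And>i. i \<ge> k0 \<Longrightarrow> q < r i" by (auto simp: eventually_sequentially)
  \<comment> \<open>An estimator of the count in \<open>B\<close> that sees only points outside
    \<open>B\<close>: for late \<open>k\<close> it equals \<open>measure X B\<close> minus the
    quantity that tends to zero.\<close>
  define T where "T k X = c k - (\<Sum>i\<in>I k. measure X (qdisc (r i) - B)) / card (I k)" for k X
  have sq: "qdisc (r i) \<in> sets disc_borel" "disc_bounded (qdisc (r i))" for i
    using r(1)[of i] by (auto simp: in_sets_disc_borel_iff disc_bounded_qdisc qdisc_subset_unit_disc)
  have Tm: "T k \<in> borel_measurable ?Q" for k
  proof -
    have "(\<lambda>X. measure X (qdisc (r i) - B)) \<in> borel_measurable ?Q" for i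
      unfolding measure_def using sq(1)[of i] B(1) qdisc_subset_unit_disc[OF r(1)[of i]]
      by (intro borel_measurable_enn2real count_measurable_completed sets.Diff) auto
    then show ?thesis unfolding T_def by measurable
  qed
  \<comment> \<open>Where the estimators diverge, \<open>lim\<close> has an unspecified value; this
    happens only on a null set, and the limit function is measurable in any case.\<close>
  have "AE X in P. ennreal (lim (\<lambda>k. T k X)) = emeasure X B"
    using conv AE_space
  proof eventually_elim
    case (elim X)
    then have X: "X \<in> Conf" by (simp add: point_process_space[OF P])
    have "T k X = measure X B - ((\<Sum>i\<in>I k. measure X (qdisc (r i))) / card (I k) - c k)" if k: "k \<ge> k0" for k
    proof -
      have "measure X (qdisc (r i) - B) = measure X (qdisc (r i)) - measure X B" if "i \<in> I k" for i
      proof (rule Conf_measure_Diff[OF X sq B(1)])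
        \<comment> \<open>The indices in the \<open>k\<close>-th average are at least
          \<open>k\<close>, so from \<open>k0\<close> on every disc in it contains
          \<open>B\<close>.\<close>
        have "q \<le> r i" using k I(1)[OF that] k0[of i] by simp
        then show "B \<subseteq> qdisc (r i)" using q(2) qdisc_mono[of q "r i"] by auto
      qed
      then have "(\<Sum>i\<in>I k. measure X (qdisc (r i) - B)) = (\<Sum>i\<in>I k. measure X (qdisc (r i))) - card (I k) * measure X B"
        by (simp add: sum_subtractf)
      then show ?thesis
        using I(2,3) by (simp add: T_def field_simps)
    qed
    then have "eventually (\<lambda>k. measure X B - ((\<Sum>i\<in>I k. measure X (qdisc (r i))) / card (I k) - c k) = T k X) sequentially"
      unfolding eventually_sequentially by metis
    moreover have "(\<lambda>k. measure X B - ((\<Sum>i\<in>I k. measure X (qdisc (r i))) / card (I k) - c k)) \<longlonglongrightarrow> measure X B - 0"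
      using elim(1) by (intro tendsto_intros)
    ultimately have "(\<lambda>k. T k X) \<longlonglongrightarrow> measure X B"
      by (simp add: Lim_transform_eventually)
    then have "lim (\<lambda>k. T k X) = measure X B" by (rule limI)
    then show ?case
      using Conf_emeasure_finite[OF X B] by (simp add: emeasure_eq_ennreal_measure)
  qed
  moreover have "(\<lambda>X. ennreal (lim (\<lambda>k. T k X))) \<in> borel_measurable ?Q"
    using Tm by measurable
  ultimately show "(\<lambda>X. emeasure X B) \<in> borel_measurable ?Q"
    by (rule completed_measurable_AE_eq[rotated])
qed

end

section \<open>Averages over dyadic discs\<close>

definition rad :: "nat \<Rightarrow> real" where
  "rad i = 1 - (1 / 2) ^ i"

text \<open>The length \<open>2 ^ k\<close> makes the expected variance of the average geometrically
  small in \<open>k\<close>. Starting at \<open>k\<close> pushes all discs of late windows beyond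
  any given compact set.\<close>

definition window :: "nat \<Rightarrow> nat set" where
  "window k = {k..<k + 2 ^ k}"

text \<open>The count covariance of the discs with indices \<open>i\<close> and \<open>j\<close> is the sum of
  \<open>x n * cov_weight i j n\<close> over \<open>n\<close>.\<close>

definition cov_weight :: "nat \<Rightarrow> nat \<Rightarrow> nat \<Rightarrow> real" where
  "cov_weight i j n = rad (min i j) ^ Suc n * (1 - rad (max i j) ^ Suc n)"

text \<open>For coefficients in \<open>{0, 1}\<close> this is the sum over \<open>k\<close> of the
  variances of the window averages, \<open>4 ^ k\<close> being the squared window size. Values in
  \<open>ennreal\<close> allow integration over \<xi> term by term before any convergence is
  known.\<close>

definition total_variance :: "(nat \<Rightarrow> real) \<Rightarrow> ennreal" where
  "total_variance x = (\<Sum>k. \<Sum>i\<in>window k. \<Sum>j\<in>window k. \<Sum>n. ennreal (x n * cov_weight i j n / 4 ^ k))"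

lemma rad_bounds: "0 \<le> rad i" "rad i < 1"
  by (auto simp: rad_def power_le_one)

lemma rad_mono: "i \<le> j \<Longrightarrow> rad i \<le> rad j"
  by (simp add: rad_def power_decreasing)

lemma window_simps [simp]: "finite (window k)" "card (window k) = 2 ^ k" "window k \<noteq> {}"
  by (auto simp: window_def)

lemma cov_weight_nonneg: "0 \<le> cov_weight i j n"
proof -
  have "rad (max i j) ^ Suc n \<le> 1"
    by (rule power_le_one[OF rad_bounds(1) less_imp_le[OF rad_bounds(2)]])
  then show ?thesis
    unfolding cov_weight_def by (intro mult_nonneg_nonneg zero_le_power rad_bounds(1)) simp
qed

text \<open>The part of the argument for a fixed realization. The expectation of the sum of all
  \<open>(Z k X)\<close> squared is \<open>total_variance x\<close>; being finite, it forces the sum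
  to be finite almost surely, hence \<open>Z k X\<close> tends to zero.\<close>

lemma number_rigid_if_total_variance_finite:
  assumes x: "\<And>n. x n = 0 \<or> x n = 1" and fin: "total_variance x < \<infinity>"
    and P: "point_process P" "determinantal (weighted_kernel x) P"
  shows "number_rigid P"
proof (rule number_rigidI[OF P(1)])
  interpret P: prob_space P by (rule point_process_prob_space[OF P(1)])
  define N where "N i X = measure X (qdisc (rad i)) - (\<integral>X. measure X (qdisc (rad i)) \<partial>P)" for i X
  define c where "c k = (\<Sum>i\<in>window k. \<integral>X. measure X (qdisc (rad i)) \<partial>P) / card (window k)" for k
  define Z where "Z k X = (\<Sum>i\<in>window k. measure X (qdisc (rad i))) / card (window k) - c k" for k X
  have ordered: "integrable P (\<lambda>X. N i X * N j X) \<and> (\<lambda>n. x n * cov_weight i j n) sums (\<integral>X. N i X * N j X \<partial>P)"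
    if "i \<le> j" for i j
  proof -
    \<comment> \<open>The larger of the two discs is the ambient one; the opposite order of the
      indices follows by symmetry.\<close>
    interpret sub_bergman x "rad j"
      by unfold_locales (use x rad_bounds in auto)
    show ?thesis
      using count_covariance[OF P rad_bounds(1) rad_mono[OF that]] that
      by (simp add: N_def cov_weight_def mult.assoc)
  qed
  have cov: "integrable P (\<lambda>X. N i X * N j X)" "(\<lambda>n. x n * cov_weight i j n) sums (\<integral>X. N i X * N j X \<partial>P)" for i j
  proof -
    have weight: "cov_weight j i = cov_weight i j"
      by (intro ext) (simp only: cov_weight_def min.commute max.commute)
    have comm: "(\<lambda>X. N j X * N i X) = (\<lambda>X. N i X * N j X)"
      by (intro ext) (rule mult.commute)
    show "integrable P (\<lambda>X. N i X * N j X)" "(\<lambda>n. x n * cov_weight i j n) sums (\<integral>X. N i X * N j X \<partial>P)"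
      using ordered[of i j] ordered[of j i, unfolded comm weight] linear[of i j] by blast+
  qed
  have Z: "(Z k X)\<^sup>2 = (\<Sum>i\<in>window k. \<Sum>j\<in>window k. N i X * N j X / 4 ^ k)" for k X
  proof -
    have "Z k X = (\<Sum>i\<in>window k. N i X) / 2 ^ k"
      by (simp add: Z_def c_def N_def sum_subtractf diff_divide_distrib)
    then have "(Z k X)\<^sup>2 = (\<Sum>i\<in>window k. N i X) * (\<Sum>j\<in>window k. N j X) / 4 ^ k"
      by (simp add: power2_eq_square flip: power_mult_distrib)
    then show ?thesis by (simp add: sum_product sum_divide_distrib)
  qed
  have int: "integrable P (\<lambda>X. (Z k X)\<^sup>2)" for k
    unfolding Z by (intro Bochner_Integration.integrable_sum integrable_divide cov)
  have expect: "(\<integral>\<^sup>+X. ennreal ((Z k X)\<^sup>2) \<partial>P) = (\<Sum>i\<in>window k. \<Sum>j\<in>window k. \<Sum>n. ennreal (x n * cov_weight i j n / 4 ^ k))" for k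
  proof -
    have nonneg: "0 \<le> x n * cov_weight i j n / 4 ^ k" for i j n
      using x[of n] cov_weight_nonneg[of i j n] by auto
    have s: "(\<lambda>n. x n * cov_weight i j n / 4 ^ k) sums ((\<integral>X. N i X * N j X \<partial>P) / 4 ^ k)" for i j
      by (rule sums_divide[OF cov(2)])
    have "(\<integral>\<^sup>+X. ennreal ((Z k X)\<^sup>2) \<partial>P) = ennreal (\<integral>X. (Z k X)\<^sup>2 \<partial>P)"
      by (rule nn_integral_eq_integral[OF int]) simp
    also have "(\<integral>X. (Z k X)\<^sup>2 \<partial>P) = (\<Sum>i\<in>window k. \<Sum>j\<in>window k. (\<integral>X. N i X * N j X \<partial>P) / 4 ^ k)"
      unfolding Z by (simp add: Bochner_Integration.integral_sum Bochner_Integration.integrable_sum integrable_divide cov)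
    also have "\<dots> = (\<Sum>i\<in>window k. \<Sum>j\<in>window k. \<Sum>n. x n * cov_weight i j n / 4 ^ k)"
      by (simp add: sums_unique[OF s])
    also have "ennreal \<dots> = (\<Sum>i\<in>window k. \<Sum>j\<in>window k. ennreal (\<Sum>n. x n * cov_weight i j n / 4 ^ k))"
      by (simp only: sum_ennreal sum_nonneg suminf_nonneg[OF sums_summable[OF s] nonneg])
    also have "\<dots> = (\<Sum>i\<in>window k. \<Sum>j\<in>window k. \<Sum>n. ennreal (x n * cov_weight i j n / 4 ^ k))"
      by (intro sum.cong refl suminf_ennreal2[symmetric] nonneg sums_summable[OF s])
    finally show ?thesis .
  qed
  have meas: "(\<lambda>X. ennreal ((Z k X)\<^sup>2)) \<in> borel_measurable P" for k
    using borel_measurable_integrable[OF int] by measurable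
  have "(\<integral>\<^sup>+X. (\<Sum>k. ennreal ((Z k X)\<^sup>2)) \<partial>P) = total_variance x"
    unfolding total_variance_def by (simp add: nn_integral_suminf meas expect)
  then have "AE X in P. (\<Sum>k. ennreal ((Z k X)\<^sup>2)) \<noteq> \<infinity>"
    using fin meas by (intro nn_integral_PInf_AE) auto
  then show "AE X in P. (\<lambda>k. (\<Sum>i\<in>window k. measure X (qdisc (rad i))) / card (window k) - c k) \<longlonglongrightarrow> 0"
  proof eventually_elim
    case (elim X)
    then have "summable (\<lambda>k. (Z k X)\<^sup>2)"
      by (intro summable_suminf_not_top) auto
    then have "(\<lambda>k. sqrt ((Z k X)\<^sup>2)) \<longlonglongrightarrow> sqrt 0"
      by (intro tendsto_real_sqrt summable_LIMSEQ_zero)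
    then have "(\<lambda>k. Z k X) \<longlonglongrightarrow> 0"
      by (simp add: tendsto_rabs_zero_iff)
    then show ?case by (simp add: Z_def)
  qed
  show "rad \<longlonglongrightarrow> 1"
    using tendsto_diff[OF tendsto_const[of 1] LIMSEQ_power_zero[of "1 / 2 :: real"]]
    by (simp add: rad_def[abs_def])
qed (auto simp: window_def rad_bounds)

section \<open>Averaging the variances over the random coefficients\<close>

lemma sum_half_power_le: "finite S \<Longrightarrow> (\<Sum>d\<in>S. (1 / 2 :: real) ^ d) \<le> 2"
  using sum_le_suminf[of "\<lambda>d. (1 / 2 :: real) ^ d" S] by (simp add: suminf_geometric)

text \<open>The exponent is the distance of \<open>i\<close> and \<open>j\<close>. On each side of
  \<open>i\<close> every distance occurs at most once, so each side contributes at most a full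
  geometric series.\<close>

lemma sum_half_power_dist_le:
  assumes "finite J"
  shows "(\<Sum>j\<in>J. (1 / 2 :: real) ^ (max i j - min i j)) \<le> 4"
proof -
  have "(\<Sum>j\<in>J. (1 / 2 :: real) ^ (max i j - min i j)) =
      (\<Sum>j\<in>J \<inter> {..i}. (1 / 2) ^ (i - j)) + (\<Sum>j\<in>J \<inter> {i<..}. (1 / 2) ^ (j - i))"
  proof -
    have "J = (J \<inter> {..i}) \<union> (J \<inter> {i<..})" by auto
    then have "(\<Sum>j\<in>J. (1 / 2 :: real) ^ (max i j - min i j)) =
       (\<Sum>j\<in>J \<inter> {..i}. (1 / 2) ^ (max i j - min i j)) + (\<Sum>j\<in>J \<inter> {i<..}. (1 / 2) ^ (max i j - min i j))"
      using assms by (subst sum.union_disjoint[symmetric]) auto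
    moreover have "(\<Sum>j\<in>J \<inter> {..i}. (1 / 2 :: real) ^ (max i j - min i j)) = (\<Sum>j\<in>J \<inter> {..i}. (1 / 2) ^ (i - j))"
      by (rule sum.cong) auto
    moreover have "(\<Sum>j\<in>J \<inter> {i<..}. (1 / 2 :: real) ^ (max i j - min i j)) = (\<Sum>j\<in>J \<inter> {i<..}. (1 / 2) ^ (j - i))"
      by (rule sum.cong) auto
    ultimately show ?thesis by simp
  qed
  also have "(\<Sum>j\<in>J \<inter> {..i}. (1 / 2 :: real) ^ (i - j)) = (\<Sum>d\<in>(\<lambda>j. i - j) ` (J \<inter> {..i}). (1 / 2) ^ d)"
    by (subst sum.reindex) (auto simp: inj_on_def)
  also have "(\<Sum>j\<in>J \<inter> {i<..}. (1 / 2 :: real) ^ (j - i)) = (\<Sum>d\<in>(\<lambda>j. j - i) ` (J \<inter> {i<..}). (1 / 2) ^ d)"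
    by (subst sum.reindex) (auto simp: inj_on_def)
  finally show ?thesis
    using sum_half_power_le[of "(\<lambda>j. i - j) ` (J \<inter> {..i})"] sum_half_power_le[of "(\<lambda>j. j - i) ` (J \<inter> {i<..})"] assms
    by simp
qed

text \<open>The factor \<open>1 / (real n + 1)\<close> is the mean of the \<open>n\<close>-th
  coefficient. Bernoulli's inequality bounds \<open>1 - (1 - d) ^ Suc n\<close> by
  \<open>(real n + 1) * d\<close>, which cancels it; what remains is a geometric series of ratio
  \<open>p\<close> with sum \<open>d * p / (1 - p)\<close>.\<close>

lemma cov_weight_expectation_le:
  "(\<Sum>n. ennreal (cov_weight i j n / (real n + 1))) \<le> ennreal ((1 / 2) ^ (max i j - min i j))"
proof -
  define p where "p = rad (min i j)"
  define d where "d = (1 / 2 :: real) ^ max i j"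
  have p: "0 \<le> p" "p < 1" using rad_bounds by (auto simp: p_def)
  have bound: "cov_weight i j n / (real n + 1) \<le> d * p * p ^ n" for n
  proof -
    have "1 + real (Suc n) * (- d) \<le> (1 + (- d)) ^ Suc n"
      by (rule Bernoulli_inequality) (simp add: d_def power_le_one)
    then have "1 - rad (max i j) ^ Suc n \<le> (real n + 1) * d"
      by (simp add: rad_def d_def[symmetric] algebra_simps)
    then have "p ^ Suc n * (1 - rad (max i j) ^ Suc n) \<le> p ^ Suc n * ((real n + 1) * d)"
      using p by (intro mult_left_mono) auto
    then show ?thesis
      by (simp add: cov_weight_def p_def[symmetric] divide_le_eq algebra_simps)
  qed
  have s: "(\<lambda>n. d * p * p ^ n) sums (d * p * (1 / (1 - p)))"
    using p by (intro sums_mult geometric_sums) simp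
  have "(\<Sum>n. ennreal (cov_weight i j n / (real n + 1))) \<le> (\<Sum>n. ennreal (d * p * p ^ n))"
    by (intro suminf_le ennreal_leI bound) auto
  also have "\<dots> = ennreal (d * p * (1 / (1 - p)))"
    using p s by (subst suminf_ennreal2) (auto simp: d_def sums_iff)
  also have "\<dots> \<le> ennreal ((1 / 2) ^ (max i j - min i j))"
  proof (rule ennreal_leI)
    have "1 - p = (1 / 2) ^ min i j" by (simp add: p_def rad_def)
    then have "d * (1 / (1 - p)) = (1 / 2) ^ (max i j - min i j)"
      unfolding d_def by (subst power_diff) auto
    moreover have "d * (1 / (1 - p)) * p \<le> d * (1 / (1 - p)) * 1"
      using p by (intro mult_left_mono) (auto simp: d_def)
    moreover have "d * p * (1 / (1 - p)) = d * (1 / (1 - p)) * p" by simp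
    ultimately show "d * p * (1 / (1 - p)) \<le> (1 / 2) ^ (max i j - min i j)"
      by linarith
  qed
  finally show ?thesis .
qed

text \<open>A window has \<open>2 ^ k\<close> rows, each with sum at most \<open>4\<close>; after
  division by \<open>4 ^ k\<close> the bound \<open>4 * (1 / 2) ^ k\<close> is summable.\<close>

lemma expected_total_variance_finite:
  "(\<Sum>k. \<Sum>i\<in>window k. \<Sum>j\<in>window k. \<Sum>n. ennreal (cov_weight i j n / 4 ^ k / (real n + 1))) < \<infinity>"
proof -
  have "(\<Sum>i\<in>window k. \<Sum>j\<in>window k. \<Sum>n. ennreal (cov_weight i j n / 4 ^ k / (real n + 1))) \<le> ennreal (4 * (1 / 2) ^ k)" for k
  proof -
    have "(\<Sum>n. ennreal (cov_weight i j n / 4 ^ k / (real n + 1))) \<le> ennreal ((1 / 4) ^ k * (1 / 2) ^ (max i j - min i j))" for i j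
    proof -
      have "(\<Sum>n. ennreal (cov_weight i j n / 4 ^ k / (real n + 1))) = (\<Sum>n. ennreal ((1 / 4) ^ k) * ennreal (cov_weight i j n / (real n + 1)))"
        by (intro suminf_cong) (simp add: ennreal_mult'[symmetric] power_one_over)
      also have "\<dots> = ennreal ((1 / 4) ^ k) * (\<Sum>n. ennreal (cov_weight i j n / (real n + 1)))"
        by (rule ennreal_suminf_cmult)
      also have "\<dots> \<le> ennreal ((1 / 4) ^ k) * ennreal ((1 / 2) ^ (max i j - min i j))"
        by (intro mult_left_mono cov_weight_expectation_le) simp
      finally show ?thesis by (simp add: ennreal_mult')
    qed
    then have "(\<Sum>i\<in>window k. \<Sum>j\<in>window k. \<Sum>n. ennreal (cov_weight i j n / 4 ^ k / (real n + 1)))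
      \<le> (\<Sum>i\<in>window k. \<Sum>j\<in>window k. ennreal ((1 / 4) ^ k * (1 / 2) ^ (max i j - min i j)))"
      by (intro sum_mono)
    also have "\<dots> = ennreal (\<Sum>i\<in>window k. (1 / 4) ^ k * (\<Sum>j\<in>window k. (1 / 2) ^ (max i j - min i j)))"
      by (simp add: sum_ennreal sum_nonneg sum_distrib_left)
    also have "\<dots> \<le> ennreal (\<Sum>i\<in>window k. (1 / 4) ^ k * 4)"
      by (intro ennreal_leI sum_mono mult_left_mono sum_half_power_dist_le) auto
    also have "(\<Sum>i\<in>window k. (1 / 4 :: real) ^ k * 4) = 4 * (1 / 2) ^ k"
      by (simp add: power_one_over field_simps flip: power_mult_distrib)
    finally show ?thesis .
  qed
  then have "(\<Sum>k. \<Sum>i\<in>window k. \<Sum>j\<in>window k. \<Sum>n. ennreal (cov_weight i j n / 4 ^ k / (real n + 1)))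
    \<le> (\<Sum>k. ennreal (4 * (1 / 2) ^ k))"
    by (intro suminf_le) auto
  also have "\<dots> = ennreal (\<Sum>k. 4 * (1 / 2) ^ k)"
    by (intro suminf_ennreal2) (auto intro!: summable_mult summable_geometric)
  also have "\<dots> < \<infinity>" by simp
  finally show ?thesis .
qed

lemma borel_measurable_total_variance [measurable]:
  "total_variance \<in> borel_measurable (Pi\<^sub>M UNIV (\<lambda>_. borel))"
  unfolding total_variance_def[abs_def] by measurable

text \<open>The exceptional null set is fixed before \<open>P\<close>: it is where some coefficient
  leaves \<open>{0, 1}\<close> or \<open>total_variance\<close> is infinite, and neither condition
  mentions \<open>P\<close>.\<close>

theorem theorem1p3:
  fixes M :: "'a measure" and \<xi> :: "nat \<Rightarrow> 'a \<Rightarrow> real"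
  assumes "prob_space M"
    and "prob_space.indep_vars M (\<lambda>_. borel) \<xi> UNIV"
    and "\<And>n. measure M {\<omega> \<in> space M. \<xi> n \<omega> = 1} = 1 / (real n + 1)"
    and "\<And>n. measure M {\<omega> \<in> space M. \<xi> n \<omega> = 0} = 1 - 1 / (real n + 1)"
  shows "AE x in distr M (Pi\<^sub>M UNIV (\<lambda>_. borel)) (\<lambda>\<omega> n. \<xi> n \<omega>).
           \<forall>P. point_process P \<longrightarrow> determinantal (weighted_kernel x) P \<longrightarrow> number_rigid P"
proof -
  interpret prob_space M by fact
  have \<xi> [measurable]: "\<xi> n \<in> borel_measurable M" for n
    using assms(2) by (auto simp: indep_vars_def)
  \<comment> \<open>The two given probabilities add up to one, so any other value is taken only on a
    null set.\<close>
  have binary: "AE \<omega> in M. \<xi> n \<omega> = 0 \<or> \<xi> n \<omega> = 1" for n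
  proof -
    have "prob {\<omega> \<in> space M. \<xi> n \<omega> = 0 \<or> \<xi> n \<omega> = 1}
        = prob ({\<omega> \<in> space M. \<xi> n \<omega> = 0} \<union> {\<omega> \<in> space M. \<xi> n \<omega> = 1})"
      by (rule arg_cong[where f = prob]) auto
    also have "\<dots> = 1"
      by (subst finite_measure_Union) (auto simp: assms(3,4))
    finally show ?thesis
      by (subst prob_Collect_eq_1[symmetric]) measurable
  qed
  have single: "(\<integral>\<^sup>+\<omega>. ennreal (\<xi> n \<omega> * a / b) \<partial>M) = ennreal (a / b / (real n + 1))" if "0 \<le> a" "0 \<le> b" for n a b
  proof -
    have "(\<integral>\<^sup>+\<omega>. ennreal (\<xi> n \<omega> * a / b) \<partial>M) = (\<integral>\<^sup>+\<omega>. ennreal (a / b) * indicator {\<omega> \<in> space M. \<xi> n \<omega> = 1} \<omega> \<partial>M)"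
    proof (rule nn_integral_cong_AE)
      show "AE \<omega> in M. ennreal (\<xi> n \<omega> * a / b) = ennreal (a / b) * indicator {\<omega> \<in> space M. \<xi> n \<omega> = 1} \<omega>"
        using binary[of n] AE_space by eventually_elim (auto simp: indicator_def)
    qed
    also have "\<dots> = ennreal (a / b) * ennreal (1 / (real n + 1))"
      by (subst nn_integral_cmult_indicator) (auto simp: emeasure_eq_measure assms(3))
    finally show ?thesis
      using that by (simp add: ennreal_mult[symmetric])
  qed
  \<comment> \<open>All terms are \<open>ennreal\<close> valued, so the expectation passes through
    the finite and infinite sums and acts on single coefficients.\<close>
  have "(\<integral>\<^sup>+\<omega>. total_variance (\<lambda>n. \<xi> n \<omega>) \<partial>M) < \<infinity>"
    using expected_total_variance_finite
    by (simp add: total_variance_def nn_integral_suminf nn_integral_sum single cov_weight_nonneg)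
  moreover have meas: "(\<lambda>\<omega> n. \<xi> n \<omega>) \<in> measurable M (Pi\<^sub>M UNIV (\<lambda>_. borel))"
    by (rule measurable_PiM_single') (auto simp: \<xi>)
  ultimately have "AE \<omega> in M. total_variance (\<lambda>n. \<xi> n \<omega>) \<noteq> \<infinity>"
    by (intro nn_integral_PInf_AE measurable_compose[OF meas]) auto
  moreover have "AE \<omega> in M. \<forall>n. \<xi> n \<omega> = 0 \<or> \<xi> n \<omega> = 1"
    using binary by (simp add: AE_all_countable)
  ultimately have "AE \<omega> in M. (\<forall>n. \<xi> n \<omega> = 0 \<or> \<xi> n \<omega> = 1) \<and> total_variance (\<lambda>n. \<xi> n \<omega>) \<noteq> \<infinity>"
    by eventually_elim simp
  \<comment> \<open>Both conditions define a measurable set of sequences, so they transfer to the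
    law of the sequence; rigidity is then derived for each such sequence.\<close>
  then have "AE x in distr M (Pi\<^sub>M UNIV (\<lambda>_. borel)) (\<lambda>\<omega> n. \<xi> n \<omega>).
      (\<forall>n. x n = 0 \<or> x n = 1) \<and> total_variance x \<noteq> \<infinity>"
    by (subst AE_distr_iff[OF meas]) measurable
  then show ?thesis
  proof eventually_elim
    case (elim x)
    then show ?case
      using number_rigid_if_total_variance_finite[of x] by (auto simp: less_top)
  qed
qed

end
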